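(* Let $(n_0,\dots,n_m;1)$ be any architecture of feedforward ReLU neural network, and let $D=\sum_{i=0}^m(n_i+1)n_{i+1}$ (with $n_{m+1}=1$) be the dimension of its parameter space. For almost every choice of parameters in $\mathbb{R}^{D}$ (with respect to Lebesgue measure), the associated ReLU neural network is generic and transversal.
   Context: **ReLU networks.** $\mathrm{ReLU}(x)=\max\{0,x\}$, and $\sigma:\mathbb{R}^n\to\mathbb{R}^n$ applies ReLU to each coordinate. A ReLU neural network of architecture $(n_0,\dots,n_m;1)$ (positive integers $n_0,\ldots,n_m$, $n_{m+1}=1$) is a sequence of affine maps $A_i:\mathbb{R}^{n_{i-1}}\to\mathbb{R}^{n_i}$, $A_i(x)=W^{(i)}x+b^{(i)}$, $i=1,\dots,m+1$; its layer maps are $F_i=\sigma\circ A_i$ for $i\le m$ and $G=A_{m+1}$, and the network map is $F=G\circ F_m\circ\cdots\circ F_1$. A point of $\mathbb{R}^D$ lists all entries of all $W^{(i)},b^{(i)}$. **Generic.** For the layer map with affine part $A:\mathbb{R}^n\to\mathbb{R}^k$, $A(x)=Wx+b$, let $S_j=\{x\in\mathbb{R}^n: W_j\cdot x+b_j=0\}$, $j=1,\dots,k$ (degenerate if $W_j=0$, otherwise a hyperplane). The layer map is generic if for every set of $p$ distinct indices $j_1,\dots,j_p$, $S_{j_1}\cap\cdots\cap S_{j_p}$ is an affine subspace of $\mathbb{R}^n$ of dimension $n-p$ (empty if $n-p<0$). A network is generic if all its layer maps (including $G$) are generic. The hyperplane arrangement $\mathcal{A}^{(i)}$ associated to $F_i$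 is the set of nondegenerate $S_j$ for $A_i$. **Polyhedral complexes.** A polyhedral set is a finite intersection of closed affine half-spaces. A polyhedral complex is a finite set of polyhedral sets (cells) closed under taking faces and such that any two cells intersect in a common face. A hyperplane arrangement $\mathcal{A}$ in $\mathbb{R}^n$ induces the polyhedral complex $\mathcal{C}(\mathcal{A})$ with underlying set $\mathbb{R}^n$ whose $n$-cells are the closures of the connected components of $\mathbb{R}^n\setminus\bigcup_{H\in\mathcal{A}}H$ and whose other cells are the faces of these. **Canonical complex.** Let $R^{(i)}=\mathcal{C}(\mathcal{A}^{(i)})$. Set $\mathcal{C}(F_1):=R^{(1)}$ and, for $i=2,\dots,m$, let $\mathcal{C}(F_i\circ\cdots\circ F_1)$ be the polyhedral complex $\{S\cap (F_{i-1}\circ\cdots\circ F_1)^{-1}(Y): S\in\mathcal{C}(F_{i-1}\circ\cdots\circ F_1),\ Y\in R^{(i)}\}$. The canonical polyhedral complex of $F$ is $\mathcal{C}(F):=\mathcal{C}(F_m\circ\cdots\circ F_1)$. It has underlying set $\mathbb{R}^{n_0}$ and $F$ is affine-linear on each of its cells. For a network with no hidden layers it is the trivial decomposition with single nonempty cell $\mathbb{R}^{n_0}$. **Transversal.** For a polyhedral complex $M$ in $\mathbb{R}^{n_0}$ and $f:|M|\to\mathbb{R}$ affine-linear on cells, $t\in\mathbb{R}$ is a transversal threshold for $f$ and $M$ if for every cell $C$ of dimension $\ge1$ the restriction of $f$ to the relative interior $\mathrm{int}(C)$ is transverse to $\{t\}$ (its differential is surjective at every point of $\mathrm{int}(C)\cap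 f^{-1}(t)$), and $f(v)\neq t$ for every $0$-cell $v$. A threshold is transversal for a network if it is so for the network map and its canonical complex. For $i\in\{1,\dots,m\}$, $j\in\{1,\dots,n_i\}$ the node map is $F_{i,j}=\pi_j\circ A_i\circ F_{i-1}\circ\cdots\circ F_1:\mathbb{R}^{n_0}\to\mathbb{R}$ ($\pi_j$ the $j$-th coordinate projection), itself a ReLU network of architecture $(n_0,\dots,n_{i-1};1)$. $F$ is transversal if $t=0$ is a transversal threshold for every node map $F_{i,j}$, $1\le i\le m$, $1\le j\le n_i$. *)

theory Defs
  imports "HOL-Analysis.Analysis" "HOL-Analysis.Finite_Function_Topology"
begin

text \<open>
  The dimensions of the layers of a network are numbers that vary with the layer, so all the spaces
  \<open>\<real>\<^sup>n\<close> are realised inside one real normed vector space, the finitely supported real sequences: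
  \<open>\<real>\<^sup>n\<close> is the subspace of the sequences supported in \<open>{..<n}\<close>. The ambient norm is the sum norm,
  which on \<open>\<real>\<^sup>n\<close> induces the Euclidean topology. Since \<open>\<real>\<^sup>n\<close> is closed, closures, components, faces,
  affine hulls and relative interiors of subsets of \<open>\<real>\<^sup>n\<close> agree with those computed in \<open>\<real>\<^sup>n\<close>.
  Coordinates are numbered from \<open>0\<close>.
\<close>

type_synonym rvec = "nat \<Rightarrow>\<^sub>0 real"

definition Rn :: "nat \<Rightarrow> rvec set" where
  "Rn n = {x. Poly_Mapping.keys x \<subseteq> {..<n}}"

definition mk_vec :: "nat \<Rightarrow> (nat \<Rightarrow> real) \<Rightarrow> rvec" where
  "mk_vec k f = (\<Sum>j<k. Poly_Mapping.single j (f j))"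

lemma lookup_mk_vec: "Poly_Mapping.lookup (mk_vec k f) j = (if j < k then f j else 0)"
  by (simp add: mk_vec_def lookup_sum lookup_single when_def)

lemma mk_vec_in_Rn: "mk_vec k f \<in> Rn k"
  by (auto simp: Rn_def lookup_mk_vec in_keys_iff split: if_splits)

text \<open>
  The library's \<^const>\<open>aff_dim\<close> requires a Euclidean space type. As there, the empty set has
  dimension \<open>-1\<close>; otherwise the dimension is that of the direction space of the affine hull, which
  is spanned by the differences of points.
\<close>

definition directions :: "rvec set \<Rightarrow> rvec set" where
  "directions S = span {x - y |x y. x \<in> S \<and> y \<in> S}"

definition affdim :: "rvec set \<Rightarrow> int" where
  "affdim S = (if S = {} then -1 else int (dim (directions S)))"

text \<open>
  An affine map \<open>\<real>\<^sup>n \<rightarrow> \<real>\<^sup>k\<close> is given by the entries \<open>W j l\<close> and \<open>b j\<close> with \<open>j < k\<close>, \<open>l < n\<close>;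
  other values of \<open>W\<close> and \<open>b\<close> are ignored.
\<close>

definition affine_row :: "nat \<Rightarrow> (nat \<Rightarrow> real) \<Rightarrow> real \<Rightarrow> rvec \<Rightarrow> real" where
  "affine_row n w c x = (\<Sum>l<n. w l * Poly_Mapping.lookup x l) + c"

definition affine_map ::
    "nat \<Rightarrow> nat \<Rightarrow> (nat \<Rightarrow> nat \<Rightarrow> real) \<Rightarrow> (nat \<Rightarrow> real) \<Rightarrow> rvec \<Rightarrow> rvec" where
  "affine_map n k W b x = mk_vec k (\<lambda>j. affine_row n (W j) (b j) x)"

definition relu :: "rvec \<Rightarrow> rvec" where
  "relu = Poly_Mapping.map (\<lambda>t. max 0 t)"

definition solution_set :: "nat \<Rightarrow> (nat \<Rightarrow> real) \<Rightarrow> real \<Rightarrow> rvec set" where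
  "solution_set n w c = {x \<in> Rn n. affine_row n w c x = 0}"

text \<open>The factor \<open>Rn n\<close> matters for \<open>J = {}\<close> only, where the empty intersection is all of \<open>\<real>\<^sup>n\<close>.\<close>

definition generic_layer ::
    "nat \<Rightarrow> nat \<Rightarrow> (nat \<Rightarrow> nat \<Rightarrow> real) \<Rightarrow> (nat \<Rightarrow> real) \<Rightarrow> bool" where
  "generic_layer n k W b \<longleftrightarrow>
     (\<forall>J \<subseteq> {..<k}.
        let S = Rn n \<inter> (\<Inter>j\<in>J. solution_set n (W j) (b j))
        in if card J \<le> n then affine S \<and> affdim S = int n - int (card J) else S = {})"

definition layer_arrangement ::
    "nat \<Rightarrow> nat \<Rightarrow> (nat \<Rightarrow> nat \<Rightarrow> real) \<Rightarrow> (nat \<Rightarrow> real) \<Rightarrow> rvec set set" where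
  "layer_arrangement n k W b =
     {solution_set n (W j) (b j) |j. j < k \<and> (\<exists>l<n. W j l \<noteq> 0)}"

definition top_cells :: "nat \<Rightarrow> rvec set set \<Rightarrow> rvec set set" where
  "top_cells n \<A> = closure ` components (Rn n - \<Union>\<A>)"

text \<open>
  With \<^const>\<open>face_of\<close> the empty set is a face. It has dimension \<open>-1\<close>, so that neither clause of
  transversality below concerns it.
\<close>

definition arrangement_complex :: "nat \<Rightarrow> rvec set set \<Rightarrow> rvec set set" where
  "arrangement_complex n \<A> = top_cells n \<A> \<union> {T. \<exists>C \<in> top_cells n \<A>. T face_of C}"

text \<open>
  The manifold \<open>rel_interior C\<close> has tangent space \<open>directions C\<close> at each of its points, and a
  derivative within it is unique on \<open>directions C\<close> only. The differential of the restriction of \<open>f\<close>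
  is therefore the restriction of \<open>D\<close> to \<open>directions C\<close>.
\<close>

definition transverse_on_cell :: "(rvec \<Rightarrow> real) \<Rightarrow> real \<Rightarrow> rvec set \<Rightarrow> bool" where
  "transverse_on_cell f t C \<longleftrightarrow>
     (\<forall>x \<in> rel_interior C. f x = t \<longrightarrow>
        (\<exists>D. (f has_derivative D) (at x within rel_interior C) \<and> D ` directions C = UNIV))"

definition transversal_threshold :: "(rvec \<Rightarrow> real) \<Rightarrow> rvec set set \<Rightarrow> real \<Rightarrow> bool" where
  "transversal_threshold f M t \<longleftrightarrow>
     (\<forall>C \<in> M. affdim C \<ge> 1 \<longrightarrow> transverse_on_cell f t C) \<and>
     (\<forall>C \<in> M. affdim C = 0 \<longrightarrow> (\<forall>v \<in> C. f v \<noteq> t))"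

text \<open>
  A network of architecture \<open>(n\<^sub>0, \<dots>, n\<^sub>m; 1)\<close> has \<open>depth = m\<close> and \<open>width i = n\<^sub>i\<close> for \<open>i \<le> m + 1\<close>;
  \<open>weight i j l\<close> and \<open>bias i j\<close> are the entries of the affine map \<open>A\<^sub>i\<close>, where \<open>1 \<le> i \<le> m + 1\<close>,
  \<open>j < n\<^sub>i\<close> and \<open>l < n\<^sub>i\<^sub>-\<^sub>1\<close>.
\<close>

record relu_network =
  depth :: nat
  width :: "nat \<Rightarrow> nat"
  weight :: "nat \<Rightarrow> nat \<Rightarrow> nat \<Rightarrow> real"
  bias :: "nat \<Rightarrow> nat \<Rightarrow> real"

definition layer_affine :: "relu_network \<Rightarrow> nat \<Rightarrow> rvec \<Rightarrow> rvec" where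
  "layer_affine N i = affine_map (width N (i - 1)) (width N i) (weight N i) (bias N i)"

definition layer_map :: "relu_network \<Rightarrow> nat \<Rightarrow> rvec \<Rightarrow> rvec" where
  "layer_map N i = relu \<circ> layer_affine N i"

text \<open>\<open>hidden_map N i\<close> is \<open>F\<^sub>i \<circ> \<dots> \<circ> F\<^sub>1\<close>.\<close>

primrec hidden_map :: "relu_network \<Rightarrow> nat \<Rightarrow> rvec \<Rightarrow> rvec" where
  "hidden_map N 0 = id"
| "hidden_map N (Suc i) = layer_map N (Suc i) \<circ> hidden_map N i"

definition network_map :: "relu_network \<Rightarrow> rvec \<Rightarrow> real" where
  "network_map N x =
     Poly_Mapping.lookup (layer_affine N (Suc (depth N)) (hidden_map N (depth N) x)) 0"

definition layer_complex :: "relu_network \<Rightarrow> nat \<Rightarrow> rvec set set" where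
  "layer_complex N i =
     arrangement_complex (width N (i - 1))
       (layer_arrangement (width N (i - 1)) (width N i) (weight N i) (bias N i))"

text \<open>\<open>partial_complex N i\<close> is the complex of \<open>F\<^sub>i \<circ> \<dots> \<circ> F\<^sub>1\<close>.\<close>

fun partial_complex :: "relu_network \<Rightarrow> nat \<Rightarrow> rvec set set" where
  "partial_complex N 0 = {{}, Rn (width N 0)}"
| "partial_complex N (Suc 0) = layer_complex N 1"
| "partial_complex N (Suc (Suc i)) =
     {S \<inter> hidden_map N (Suc i) -` Y |S Y.
        S \<in> partial_complex N (Suc i) \<and> Y \<in> layer_complex N (Suc (Suc i))}"

definition canonical_complex :: "relu_network \<Rightarrow> rvec set set" where
  "canonical_complex N = partial_complex N (depth N)"

definition generic_network :: "relu_network \<Rightarrow> bool" where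
  "generic_network N \<longleftrightarrow>
     (\<forall>i \<in> {1..Suc (depth N)}.
        generic_layer (width N (i - 1)) (width N i) (weight N i) (bias N i))"

text \<open>
  The node map \<open>F\<^sub>i\<^sub>,\<^sub>j\<close> is the map of the network with hidden layers \<open>F\<^sub>1, \<dots>, F\<^sub>i\<^sub>-\<^sub>1\<close> whose output
  layer is row \<open>j\<close> of \<open>A\<^sub>i\<close>.
\<close>

definition node_network :: "relu_network \<Rightarrow> nat \<Rightarrow> nat \<Rightarrow> relu_network" where
  "node_network N i j =
     \<lparr>depth = i - 1,
      width = (width N)(i := 1),
      weight = (weight N)(i := (\<lambda>_. weight N i j)),
      bias = (bias N)(i := (\<lambda>_. bias N i j))\<rparr>"

definition threshold_transversal_for :: "relu_network \<Rightarrow> real \<Rightarrow> bool" where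
  "threshold_transversal_for N t \<longleftrightarrow>
     transversal_threshold (network_map N) (canonical_complex N) t"

definition transversal_network :: "relu_network \<Rightarrow> bool" where
  "transversal_network N \<longleftrightarrow>
     (\<forall>i \<in> {1..depth N}. \<forall>j < width N i. threshold_transversal_for (node_network N i j) 0)"

lemma hidden_map_node_network:
  "l < i \<Longrightarrow> hidden_map (node_network N i j) l = hidden_map N l"
  by (induction l) (simp_all add: layer_map_def layer_affine_def node_network_def)

lemma network_map_node_network:
  assumes "1 \<le> i" "j < width N i"
  shows "network_map (node_network N i j) x =
    Poly_Mapping.lookup (layer_affine N i (hidden_map N (i - 1) x)) j"
proof -
  have "hidden_map (node_network N i j) (i - 1) = hidden_map N (i - 1)"
    using assms by (simp add: hidden_map_node_network)
  moreover have "i - 1 \<noteq> i" "Suc (i - 1) = i"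
    using assms by auto
  ultimately show ?thesis
    using assms
    by (simp add: network_map_def layer_affine_def affine_map_def lookup_mk_vec node_network_def)
qed

lemma layer_complex_node_network:
  "l < i \<Longrightarrow> layer_complex (node_network N i j) l = layer_complex N l"
proof -
  assume "l < i"
  then have "l - 1 \<noteq> i" "l \<noteq> i" by auto
  then show ?thesis by (simp add: layer_complex_def node_network_def)
qed

lemma partial_complex_node_network:
  "l < i \<Longrightarrow> partial_complex (node_network N i j) l = partial_complex N l"
proof (induction N l rule: partial_complex.induct)
  case (1 N)
  then show ?case by (simp add: node_network_def)
next
  case (2 N)
  then show ?case by (simp add: layer_complex_node_network)
next
  case (3 N l)
  then show ?case
    by (simp add: layer_complex_node_network hidden_map_node_network del: hidden_map.simps)
qed

lemma canonical_complex_node_network: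
  "1 \<le> i \<Longrightarrow> canonical_complex (node_network N i j) = partial_complex N (i - 1)"
  using partial_complex_node_network[of "i - 1" i N j]
  by (simp add: canonical_complex_def) (simp add: node_network_def)

datatype parameter = Weight nat nat nat | Bias nat nat

definition parameters :: "nat \<Rightarrow> (nat \<Rightarrow> nat) \<Rightarrow> parameter set" where
  "parameters m n =
     {Weight i j l |i j l. i \<in> {1..Suc m} \<and> j < n i \<and> l < n (i - 1)} \<union>
     {Bias i j |i j. i \<in> {1..Suc m} \<and> j < n i}"

definition network_of :: "nat \<Rightarrow> (nat \<Rightarrow> nat) \<Rightarrow> (parameter \<Rightarrow> real) \<Rightarrow> relu_network" where
  "network_of m n \<theta> =
     \<lparr>depth = m, width = n,
      weight = (\<lambda>i j l. \<theta> (Weight i j l)),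
      bias = (\<lambda>i j. \<theta> (Bias i j))\<rparr>"

lemma card_parameters:
  "card (parameters m n) = (\<Sum>i\<le>m. (n i + 1) * n (Suc i))"
proof -
  let ?A = "SIGMA i:{..m}. {..<n (Suc i)} \<times> {..n i}"
  let ?f = "\<lambda>(i, j, l). if l < n i then Weight (Suc i) j l else Bias (Suc i) j"
  have "inj_on ?f ?A"
    by (auto simp: inj_on_def split: if_splits)
  moreover have "?f ` ?A = parameters m n"
  proof
    show "?f ` ?A \<subseteq> parameters m n"
      by (auto simp: parameters_def)
    show "parameters m n \<subseteq> ?f ` ?A"
    proof
      fix p assume "p \<in> parameters m n"
      then consider
        (W) i j l where "p = Weight i j l" "i \<in> {1..Suc m}" "j < n i" "l < n (i - 1)"
        | (B) i j where "p = Bias i j" "i \<in> {1..Suc m}" "j < n i"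
        unfolding parameters_def by blast
      then show "p \<in> ?f ` ?A"
      proof cases
        case W
        then have *: "(i - 1, j, l) \<in> ?A" "p = ?f (i - 1, j, l)" by auto
        show ?thesis using * by (intro rev_image_eqI[where f = ?f])
      next
        case B
        then have *: "(i - 1, j, n (i - 1)) \<in> ?A" "p = ?f (i - 1, j, n (i - 1))" by auto
        show ?thesis using * by (intro rev_image_eqI[where f = ?f])
      qed
    qed
  qed
  ultimately have "card (parameters m n) = card ?A"
    using card_image[of ?f ?A] by simp
  also have "\<dots> = (\<Sum>i\<le>m. (n i + 1) * n (Suc i))"
    by (simp add: card_SigmaI algebra_simps)
  finally show ?thesis .
qed

end

theory Submission
  imports Defs
begin

text \<open>
  On every cell the node map is affine, so transversality to \<open>0\<close> on a nonempty cell just says that the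
  node map does not vanish identically there. With all other parameters fixed, the cell does not
  depend on the bias of the node, and at most one value of that bias makes the node map vanish
  identically on it; by Fubini the exceptional parameters form a null set. Genericity is obtained in
  the same way by adding the rows of a layer one at a time: a further row must be nonconstant on the
  intersection of the previous ones (perturb one weight) and, when that intersection is a point, must
  not vanish there (perturb the bias). Cells are described by closed sign conditions on the node maps,
  so only finitely many exceptional sets are involved.
\<close>

section \<open>Null sets of parameters\<close>

text \<open>The obstacle is measurability. Fubini needs a measurable exceptional set, but this set
  quantifies over the points of a polyhedron that moves with the parameters. Weak inequalities keep
  the conditions closed jointly in parameter and point, and an exhaustion of \<open>Rn n\<close> by
  compact cubes keeps projections under control. Strict sign conditions would not be closed, and
  neither would distinctness of two points, which is why nonconstancy is tested on normalised pairs.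
  The exceptional sets are indexed by all sign patterns. Which patterns are realised at a given
  parameter therefore never enters: an empty one satisfies the implication trivially. Genericity
  feeds into transversality. It gives nonzero rows, so every row contributes a hyperplane to its
  arrangement and every nonempty cell prescribes a weak sign for each earlier neuron. On such a cell
  every ReLU is one of its two linear branches.\<close>

instance parameter :: countable
  by countable_datatype

text \<open>Projection along a compact factor is a closed map. The compact factor is
  \<open>K\<close> with its subspace topology, so \<open>T\<close> is first cut down to
  \<open>UNIV \<times> K\<close>.\<close>

lemma closed_projection_compact:
  fixes T :: "('a::topological_space \<times> 'b::topological_space) set"
  assumes "closed T" "compact K"
  shows "closed {x. \<exists>y\<in>K. (x, y) \<in> T}"
proof -
  let ?P = "prod_topology euclidean (top_of_set K) :: ('a \<times> 'b) topology"
  have "compact_space (top_of_set K)"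
    using assms(2) by (simp add: compact_space_subtopology)
  then have "closed_map ?P euclidean fst"
    by (rule Abstract_Topological_Spaces.closed_map_fst)
  moreover have "?P = top_of_set (UNIV \<times> K)"
    using subtopology_Times[of "euclidean :: 'a topology" "euclidean :: 'b topology" UNIV K]
    by (simp add: euclidean_product_topology)
  moreover have "closedin (top_of_set (UNIV \<times> K)) (T \<inter> (UNIV \<times> K))"
    using closedin_closed_Int[OF assms(1), of "UNIV \<times> K"] by (simp only: Int_commute)
  ultimately have "closed (fst ` (T \<inter> (UNIV \<times> K)))"
    unfolding closed_map_def by (metis closed_closedin)
  moreover have "fst ` (T \<inter> (UNIV \<times> K)) = {x. \<exists>y\<in>K. (x, y) \<in> T}"
    by force
  ultimately show ?thesis by simp
qed

text \<open>
  The exceptional set is Borel, being a difference of countable unions of projections of closed sets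
  along compact factors, and a line in direction \<open>p\<close> meets it in at most one point.
\<close>

lemma AE_not_vanishing:
  fixes Q :: "('p::countable \<Rightarrow> real) \<Rightarrow> 'b::topological_space \<Rightarrow> bool"
    and g :: "('p \<Rightarrow> real) \<Rightarrow> 'b \<Rightarrow> real"
  assumes I: "finite I" "p \<in> I"
    and K: "\<And>r::nat. compact (K r)"
    and Q: "closed {(\<theta>, y). Q \<theta> y}"
    and g: "continuous_on UNIV (\<lambda>(\<theta>, y). g \<theta> y)"
    and indep: "\<And>\<theta> y t. Q (\<theta>(p := t)) y \<longleftrightarrow> Q \<theta> y"
    and inj: "\<And>\<theta> y s t. Q \<theta> y \<Longrightarrow> g (\<theta>(p := s)) y = 0 \<Longrightarrow> g (\<theta>(p := t)) y = 0 \<Longrightarrow> s = t"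
  shows "AE \<theta> in (\<Pi>\<^sub>M p \<in> I. (lborel :: real measure)).
    (\<exists>y \<in> (\<Union>r. K r). Q \<theta> y) \<longrightarrow> (\<exists>y \<in> (\<Union>r. K r). Q \<theta> y \<and> g \<theta> y \<noteq> 0)"
proof -
  let ?M = "\<Pi>\<^sub>M p \<in> I. (lborel :: real measure)"
  define B where "B = {\<theta>. \<exists>y \<in> (\<Union>r. K r). Q \<theta> y} -
    {\<theta>. \<exists>y \<in> (\<Union>r. K r). Q \<theta> y \<and> g \<theta> y \<noteq> 0}"
  \<comment> \<open>The condition \<open>g \<noteq> 0\<close> is open. The closed conditions with
    \<open>e\<close> = 1/(k+1) exhaust it, and \<open>e = 0\<close> gives the first set in
    \<open>B\<close>.\<close>
  have proj: "{\<theta>. \<exists>y \<in> (\<Union>r. K r). Q \<theta> y \<and> \<bar>g \<theta> y\<bar> \<ge> e} \<in> sets borel" for e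
  proof -
    have "closed {(\<theta>, y). Q \<theta> y \<and> \<bar>g \<theta> y\<bar> \<ge> e}"
    proof -
      have "closed ({(\<theta>, y). Q \<theta> y} \<inter> {z. e \<le> \<bar>case z of (\<theta>, y) \<Rightarrow> g \<theta> y\<bar>})"
        by (intro closed_Int Q closed_Collect_le continuous_intros g)
      moreover have "{(\<theta>, y). Q \<theta> y \<and> \<bar>g \<theta> y\<bar> \<ge> e} =
          {(\<theta>, y). Q \<theta> y} \<inter> {z. e \<le> \<bar>case z of (\<theta>, y) \<Rightarrow> g \<theta> y\<bar>}"
        by auto
      ultimately show ?thesis by metis
    qed
    from closed_projection_compact[OF this K]
    have "closed {\<theta>. \<exists>y \<in> K r. Q \<theta> y \<and> \<bar>g \<theta> y\<bar> \<ge> e}" for r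
      by simp
    then have "(\<Union>r. {\<theta>. \<exists>y \<in> K r. Q \<theta> y \<and> \<bar>g \<theta> y\<bar> \<ge> e}) \<in> sets borel"
      by (intro sets.countable_UN) auto
    also have "(\<Union>r. {\<theta>. \<exists>y \<in> K r. Q \<theta> y \<and> \<bar>g \<theta> y\<bar> \<ge> e}) =
        {\<theta>. \<exists>y \<in> (\<Union>r. K r). Q \<theta> y \<and> \<bar>g \<theta> y\<bar> \<ge> e}"
      by blast
    finally show ?thesis .
  qed
  have "B = {\<theta>. \<exists>y \<in> (\<Union>r. K r). Q \<theta> y \<and> \<bar>g \<theta> y\<bar> \<ge> 0} -
    (\<Union>k. {\<theta>. \<exists>y \<in> (\<Union>r. K r). Q \<theta> y \<and> \<bar>g \<theta> y\<bar> \<ge> inverse (real (Suc k))})"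
  proof -
    have "(u \<noteq> 0) \<longleftrightarrow> (\<exists>k. \<bar>u\<bar> \<ge> inverse (real (Suc k)))" for u :: real
    proof
      assume "u \<noteq> 0"
      then show "\<exists>k. \<bar>u\<bar> \<ge> inverse (real (Suc k))"
        using reals_Archimedean[of "\<bar>u\<bar>"] by (auto intro: less_imp_le)
    next
      assume "\<exists>k. \<bar>u\<bar> \<ge> inverse (real (Suc k))"
      moreover have "inverse (real (Suc k)) > 0" for k by simp
      ultimately show "u \<noteq> 0" by (metis abs_zero not_le)
    qed
    then show ?thesis unfolding B_def by auto
  qed
  then have B_borel: "B \<in> sets borel"
    by (simp only:) (intro sets.Diff sets.countable_UN proj image_subsetI)
  \<comment> \<open>\<open>B\<close> is Borel in the space of all functions, while \<open>?M\<close>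
    lives on functions equal to \<open>undefined\<close> off \<open>I\<close>. The identity pulls
    \<open>B\<close> back: each of its coordinates is a projection or a constant, and the index type
    is countable.\<close>
  have "(\<lambda>\<theta>. \<theta>) \<in> borel_measurable ?M"
  proof (rule measurable_coordinatewise_then_product)
    fix q
    show "(\<lambda>\<theta>. \<theta> q) \<in> borel_measurable ?M"
    proof (cases "q \<in> I")
      case True
      then show ?thesis
        using measurable_component_singleton[of q I "\<lambda>_. lborel :: real measure"] by simp
    next
      case False
      then have "\<theta> q = undefined" if "\<theta> \<in> space ?M" for \<theta>
        using that by (auto simp: space_PiM PiE_def extensional_def)
      then show ?thesis
        using measurable_cong[of ?M "\<lambda>\<theta>. \<theta> q" "\<lambda>_. undefined" borel] by simp
    qed
  qed
  from measurable_sets[OF this B_borel]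
  have N_sets: "B \<inter> space ?M \<in> sets ?M" by (simp add: vimage_def Int_def)
  interpret product_sigma_finite "\<lambda>_::'p. lborel :: real measure"
    by standard
  define I' where "I' = I - {p}"
  have I': "finite I'" "p \<notin> I'" "insert p I' = I"
    using I by (auto simp: I'_def)
  have "emeasure ?M (B \<inter> space ?M) = (\<integral>\<^sup>+ \<theta>. indicator (B \<inter> space ?M) \<theta> \<partial>?M)"
    using N_sets by simp
  also have "\<dots> = (\<integral>\<^sup>+ \<theta>. (\<integral>\<^sup>+ t. indicator (B \<inter> space ?M) (\<theta>(p := t)) \<partial>lborel)
      \<partial>(Pi\<^sub>M I' (\<lambda>_. lborel :: real measure)))"
    using product_nn_integral_insert[OF I'(1,2), of "indicator (B \<inter> space ?M)"] I'(3) N_sets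
    by simp
  also have "\<dots> = (\<integral>\<^sup>+ \<theta>. 0 \<partial>(Pi\<^sub>M I' (\<lambda>_. lborel :: real measure)))"
  proof (rule nn_integral_cong)
    fix \<theta>
    have "\<exists>a. {t. \<theta>(p := t) \<in> B} \<subseteq> {a}"
    proof -
      have "s = t" if st: "\<theta>(p := s) \<in> B" "\<theta>(p := t) \<in> B" for s t
      proof -
        \<comment> \<open>As \<open>Q\<close> ignores coordinate \<open>p\<close>, this
          \<open>y\<close> is admissible for both parameters, and membership in \<open>B\<close>
          makes \<open>g\<close> vanish at it for both.\<close>
        obtain y where "y \<in> (\<Union>r. K r)" "Q (\<theta>(p := s)) y"
          using st(1) unfolding B_def by blast
        then show ?thesis
          using st inj[of \<theta> y s t] unfolding B_def by (auto simp: indep)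
      qed
      then show ?thesis by blast
    qed
    then obtain a where "{t. \<theta>(p := t) \<in> B} \<subseteq> {a}" ..
    then have "t \<noteq> a \<longrightarrow> indicator (B \<inter> space ?M) (\<theta>(p := t)) = (0::ennreal)" for t
      by (auto simp: indicator_def)
    then have "AE t in lborel. indicator (B \<inter> space ?M) (\<theta>(p := t)) = (0::ennreal)"
      by (intro AE_mp[OF AE_lborel_singleton[of a], OF AE_I2])
    then have "(\<integral>\<^sup>+ t. indicator (B \<inter> space ?M) (\<theta>(p := t)) \<partial>lborel) = (\<integral>\<^sup>+ t. 0 \<partial>(lborel :: real measure))"
      by (rule nn_integral_cong_AE)
    then show "(\<integral>\<^sup>+ t. indicator (B \<inter> space ?M) (\<theta>(p := t)) \<partial>lborel) = 0"
      by simp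
  qed
  finally have "emeasure ?M (B \<inter> space ?M) = 0" by simp
  then show ?thesis
    by (intro AE_I[of _ _ "B \<inter> space ?M"] N_sets) (auto simp: B_def)
qed

section \<open>Affine sections and generic layers\<close>

lemma lookup_scaleR:
  fixes x :: "'a \<Rightarrow>\<^sub>0 real"
  shows "Poly_Mapping.lookup (r *\<^sub>R x) l = r * Poly_Mapping.lookup x l"
  by (simp add: scaleR_poly_mapping_def)

lemma abs_lookup_le_norm:
  fixes x :: "'a \<Rightarrow>\<^sub>0 real"
  shows "\<bar>Poly_Mapping.lookup x l\<bar> \<le> norm x"
proof (cases "l \<in> Poly_Mapping.keys x")
  case True
  then show ?thesis
    using member_le_sum[of l "Poly_Mapping.keys x" "\<lambda>l. \<bar>Poly_Mapping.lookup x l\<bar>"]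
    by (simp add: norm_poly_mapping_def dist_poly_mapping_def)
qed (simp add: in_keys_iff)

lemma bounded_linear_lookup: "bounded_linear (\<lambda>x::'a \<Rightarrow>\<^sub>0 real. Poly_Mapping.lookup x l)"
  by (rule bounded_linear_intro[where K = 1])
    (auto simp: lookup_add lookup_scaleR abs_lookup_le_norm)

lemma continuous_on_lookup [continuous_intros]:
  "continuous_on S f \<Longrightarrow> continuous_on S (\<lambda>z. Poly_Mapping.lookup (f z :: 'a \<Rightarrow>\<^sub>0 real) l)"
  by (rule bounded_linear.continuous_on[OF bounded_linear_lookup])

lemma Rn_iff: "x \<in> Rn n \<longleftrightarrow> (\<forall>l\<ge>n. Poly_Mapping.lookup x l = 0)"
  by (auto simp: Rn_def in_keys_iff subset_iff) (meson not_less)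

lemma subspace_Rn: "subspace (Rn n)"
  by (auto simp: subspace_def Rn_iff lookup_add lookup_scaleR)

lemma closed_Rn: "closed (Rn n)"
proof -
  have "Rn n = (\<Inter>l\<in>{n..}. {x. Poly_Mapping.lookup x l = 0})"
    by (auto simp: Rn_iff)
  also have "closed \<dots>"
    by (intro closed_INT ballI closed_Collect_eq continuous_intros)
  finally show ?thesis .
qed

lemma Rn_subset_span: "Rn n \<subseteq> span ((\<lambda>j. Poly_Mapping.single j 1) ` {..<n})"
proof
  fix x assume "x \<in> Rn n"
  then have "x = mk_vec n (Poly_Mapping.lookup x)"
    by (auto simp: Rn_iff lookup_mk_vec intro!: poly_mapping_eqI)
  also have "\<dots> = (\<Sum>j<n. Poly_Mapping.lookup x j *\<^sub>R Poly_Mapping.single j 1)"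
    unfolding mk_vec_def
    by (intro sum.cong poly_mapping_eqI) (auto simp: lookup_scaleR lookup_single when_def)
  also have "\<dots> \<in> span ((\<lambda>j. Poly_Mapping.single j 1) ` {..<n})"
    by (intro span_sum span_scale span_base) auto
  finally show "x \<in> span ((\<lambda>j. Poly_Mapping.single j 1) ` {..<n})" .
qed

text \<open>The ambient space is infinite-dimensional, so finiteness of a basis comes from lying in
  the span of \<open>n\<close> unit vectors.\<close>

lemma finite_independent_Rn:
  assumes "independent B" "B \<subseteq> Rn n"
  shows "finite B"
  using independent_span_bound[of "(\<lambda>j. Poly_Mapping.single j 1) ` {..<n}" B]
    Rn_subset_span assms by blast

definition cube :: "nat \<Rightarrow> real \<Rightarrow> rvec set" where
  "cube n r = {x \<in> Rn n. \<forall>l. \<bar>Poly_Mapping.lookup x l\<bar> \<le> r}"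

text \<open>In the infinite-dimensional ambient space closed and bounded does not imply compact.
  Induction on the dimension works: the next cube is the continuous image of the product of the
  previous one with an interval.\<close>

lemma compact_cube: "compact (cube n r)"
proof (cases "r \<ge> 0")
  case r: True
  show ?thesis
  proof (induction n)
    case 0
    have "cube 0 r \<subseteq> {0}"
      by (auto simp: cube_def Rn_iff intro!: poly_mapping_eqI)
    then show ?case
      by (meson finite_imp_compact finite_subset finite.emptyI finite.insertI)
  next
    case (Suc n)
    let ?h = "\<lambda>(x, t). x + t *\<^sub>R (Poly_Mapping.single n 1 :: rvec)"
    have "cube (Suc n) r = ?h ` (cube n r \<times> {-r..r})"
    proof (intro equalityI subsetI)
      fix x assume x: "x \<in> cube (Suc n) r"
      let ?t = "Poly_Mapping.lookup x n"
      let ?y = "x - ?t *\<^sub>R (Poly_Mapping.single n 1 :: rvec)"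
      have "?y \<in> cube n r"
        using x r by (auto simp: cube_def Rn_iff lookup_minus lookup_scaleR lookup_single when_def)
      moreover have "?t \<in> {-r..r}"
        using x by (auto simp: cube_def abs_le_iff minus_le_iff)
      moreover have "x = ?h (?y, ?t)" by simp
      ultimately show "x \<in> ?h ` (cube n r \<times> {-r..r})" by blast
    next
      fix x assume "x \<in> ?h ` (cube n r \<times> {-r..r})"
      then show "x \<in> cube (Suc n) r"
        by (auto simp: cube_def Rn_iff lookup_add lookup_scaleR lookup_single when_def abs_le_iff)
    qed
    moreover have "continuous_on UNIV ?h"
      by (simp add: case_prod_beta) (intro continuous_intros)
    ultimately show ?case
      using compact_continuous_image[OF continuous_on_subset[OF _ subset_UNIV]
          compact_Times[OF Suc compact_Icc]]
      by simp
  qed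
next
  case False
  have "\<not> \<bar>u\<bar> \<le> r" for u
    using False by linarith
  then have "cube n r = {}"
    by (simp add: cube_def)
  then show ?thesis by simp
qed

lemma UN_cube: "(\<Union>r::nat. cube n (real r)) = Rn n"
proof (intro equalityI subsetI)
  fix x assume "x \<in> Rn n"
  moreover obtain r :: nat where "norm x \<le> real r"
    using real_arch_simple by blast
  ultimately have "x \<in> cube n r"
    using abs_lookup_le_norm[of x] by (auto simp: cube_def intro: order_trans)
  then show "x \<in> (\<Union>r::nat. cube n (real r))" by blast
qed (auto simp: cube_def)

section \<open>Affine functions and the dimension of their zero sets\<close>

lemma affine_row_eq: "affine_row n w c x = affine_row n w 0 x + c"
  by (simp add: affine_row_def)

lemma bounded_linear_affine_row: "bounded_linear (affine_row n w 0)"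
  unfolding affine_row_def
  by (simp, intro bounded_linear_sum bounded_linear_const_mult bounded_linear_lookup)

lemma continuous_on_affine_row: "continuous_on S (affine_row n w c)"
  unfolding affine_row_def by (intro continuous_intros)

lemma affine_row_diff: "affine_row n w 0 (x - y) = affine_row n w c x - affine_row n w c y"
  by (simp add: affine_row_def lookup_minus right_diff_distrib sum_subtractf)

lemma affine_row_combination:
  assumes "u + v = 1"
  shows "affine_row n w c (u *\<^sub>R x + v *\<^sub>R y) = u * affine_row n w c x + v * affine_row n w c y"
proof -
  have "u * c + v * c = c" using assms by (metis distrib_right mult_1)
  then show ?thesis
    by (simp add: affine_row_def lookup_add lookup_scaleR distrib_left sum.distrib
        sum_distrib_left mult.left_commute)
qed

text \<open>Rank-nullity for one functional: a basis of the kernel together with \<open>v\<close>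
  spans \<open>V\<close>, since subtracting the multiple \<open>D x / D v\<close> of
  \<open>v\<close> moves \<open>x\<close> into the kernel. Containment in \<open>Rn n\<close> makes
  the basis finite.\<close>

lemma dim_kernel:
  assumes D: "linear D" and V: "subspace V" "V \<subseteq> Rn n" and v: "v \<in> V" "D v \<noteq> (0::real)"
  shows "dim V = Suc (dim (V \<inter> {x. D x = 0}))"
proof -
  let ?K = "V \<inter> {x. D x = 0}"
  have K: "subspace ?K"
    using D V(1) by (auto simp: subspace_def linear_0 linear_add linear_scale)
  obtain B where B: "B \<subseteq> ?K" "independent B" "?K \<subseteq> span B" "card B = dim ?K"
    using basis_exists by blast
  have "span B \<subseteq> ?K"
    using B(1) K by (rule span_minimal)
  then have vB: "v \<notin> span B" using v by auto
  have "finite B"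
    using finite_independent_Rn B V(2) by blast
  then have "card (insert v B) = Suc (dim ?K)"
    using B(4) vB span_base by (metis card_insert_disjoint)
  moreover have "independent (insert v B)"
    using B(2) vB by (simp add: independent_insert span_base)
  moreover have "V \<subseteq> span (insert v B)"
  proof
    fix x assume x: "x \<in> V"
    let ?y = "x - (D x / D v) *\<^sub>R v"
    have "D ?y = 0"
      using v D by (simp add: linear_diff linear_scale)
    moreover have "?y \<in> V"
      using x v V by (simp add: subspace_diff subspace_scale)
    ultimately have "?y \<in> span B" using B(3) by auto
    then have "?y + (D x / D v) *\<^sub>R v \<in> span (insert v B)"
      by (intro span_add span_scale span_base[of v]) (auto intro: span_mono[THEN subsetD, of B])
    then show "x \<in> span (insert v B)" by simp
  qed
  ultimately show ?thesis
    using B(1) v by (intro dim_unique[of "insert v B"]) auto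
qed

lemma dim_singleton_zero: "dim {0 :: 'a::real_vector} = 0"
  using dim_unique[of "{}" "{0 :: 'a}" 0] by (simp add: independent_empty)

lemma dim_Rn: "dim (Rn n) = n"
proof (induction n)
  case 0
  have "Rn 0 = {0}"
    by (auto simp: Rn_iff poly_mapping_eq_iff fun_eq_iff)
  then show ?case by (simp add: dim_singleton_zero)
next
  case (Suc n)
  have "Rn (Suc n) \<inter> {x. Poly_Mapping.lookup x n = 0} = Rn n"
    by (auto simp: Rn_iff) (metis le_SucE Suc_leI le_neq_implies_less)
  moreover have "dim (Rn (Suc n)) = Suc (dim (Rn (Suc n) \<inter> {x. Poly_Mapping.lookup x n = 0}))"
    by (rule dim_kernel[of _ _ "Suc n" "Poly_Mapping.single n 1"])
      (auto simp: subspace_Rn Rn_iff lookup_single when_def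
        intro: bounded_linear.linear bounded_linear_lookup)
  ultimately show ?case using Suc by simp
qed

text \<open>For an affine set the span adds nothing: its translate by any of its points is already a
  subspace.\<close>

lemma directions_base:
  assumes "affine S" "x \<in> S"
  shows "directions S = {v. x + v \<in> S}"
proof -
  have sub: "subspace {v. x + v \<in> S}"
  proof -
    have "{v. x + v \<in> S} = (\<lambda>y. y - x) ` S"
      by (auto simp: image_iff) (metis add_diff_cancel_left')
    then show ?thesis
      using affine_diffs_subspace_subtract[OF assms] by simp
  qed
  show ?thesis
  proof
    have "{y - z |y z. y \<in> S \<and> z \<in> S} \<subseteq> {v. x + v \<in> S}"
    proof clarify
      fix y z assume "y \<in> S" "z \<in> S"
      then have "(y - x) - (z - x) \<in> {v. x + v \<in> S}"
        using subspace_diff[OF sub, of "y - x" "z - x"] by simp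
      then show "x + (y - z) \<in> S" by simp
    qed
    then show "directions S \<subseteq> {v. x + v \<in> S}"
      unfolding directions_def using sub by (rule span_minimal)
    show "{v. x + v \<in> S} \<subseteq> directions S"
    proof
      fix v assume "v \<in> {v. x + v \<in> S}"
      then have "(x + v) - x \<in> directions S"
        unfolding directions_def using assms(2) by (intro span_base) blast
      then show "v \<in> directions S" by simp
    qed
  qed
qed

lemma directions_subset_Rn:
  assumes "S \<subseteq> Rn n"
  shows "directions S \<subseteq> Rn n"
  unfolding directions_def using assms
  by (intro span_minimal subspace_Rn) (auto intro: subspace_diff[OF subspace_Rn])

text \<open>Two distinct values force a zero on the line through \<open>x\<close> and
  \<open>y\<close>, so the section is nonempty. Its directions are the kernel of the linear part on
  \<open>directions S\<close>, which misses \<open>x - y\<close>.\<close>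

lemma affdim_hyperplane_section:
  assumes S: "affine S" "S \<subseteq> Rn n"
    and xy: "x \<in> S" "y \<in> S" "affine_row n w c x \<noteq> affine_row n w c y"
  shows "affine (S \<inter> solution_set n w c)"
    and "affdim (S \<inter> solution_set n w c) = affdim S - 1"
proof -
  let ?f = "affine_row n w c" and ?T = "S \<inter> solution_set n w c"
  have T: "?T = S \<inter> {z. ?f z = 0}"
    using S(2) by (auto simp: solution_set_def)
  have comb: "u *\<^sub>R p + v *\<^sub>R q \<in> S" if "u + v = 1" "p \<in> S" "q \<in> S" for u v p q
    using S(1) that by (auto simp: affine_def)
  show aff: "affine ?T"
    using S(1) unfolding T by (auto simp: affine_def affine_row_combination)
  let ?u = "?f y / (?f y - ?f x)" and ?v = "- ?f x / (?f y - ?f x)"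
  have uv: "?u + ?v = 1"
    using xy(3) by (simp add: divide_simps)
  define z where "z = ?u *\<^sub>R x + ?v *\<^sub>R y"
  have "?f z = ?u * ?f x + ?v * ?f y"
    unfolding z_def by (rule affine_row_combination[OF uv])
  also have "\<dots> = 0" by simp
  finally have z: "z \<in> ?T"
    using comb[OF uv xy(1,2)] by (simp add: T z_def)
  have dT: "directions ?T = directions S \<inter> {v. affine_row n w 0 v = 0}"
  proof -
    have "?f (z + v) = affine_row n w 0 v" for v
      using affine_row_diff[of n w "z + v" z c] z by (simp add: T)
    then show ?thesis
      using z S(1) aff by (auto simp: directions_base[of _ z] T)
  qed
  have "dim (directions S) = Suc (dim (directions ?T))"
    unfolding dT
  proof (rule dim_kernel)
    show "linear (affine_row n w 0)"
      by (rule bounded_linear.linear[OF bounded_linear_affine_row])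
    show "subspace (directions S)" by (simp add: directions_def)
    show "directions S \<subseteq> Rn n" using S(2) by (rule directions_subset_Rn)
    show "x - y \<in> directions S"
      unfolding directions_def using xy by (intro span_base) blast
    show "affine_row n w 0 (x - y) \<noteq> 0"
      using xy(3) affine_row_diff[of n w x y c] by simp
  qed
  then show "affdim ?T = affdim S - 1"
    using z xy(1) by (auto simp: affdim_def)
qed

lemma affdim_zero_singleton:
  assumes "affdim S = 0" "S \<subseteq> Rn n" "x \<in> S" "y \<in> S"
  shows "x = y"
proof -
  have "dim (directions S) = 0"
    using assms(1,3) by (auto simp: affdim_def split: if_splits)
  moreover obtain B where B: "B \<subseteq> directions S" "independent B" "directions S \<subseteq> span B"
      "card B = dim (directions S)"
    using basis_exists by blast
  moreover have "finite B"
    using finite_independent_Rn[of B n] B directions_subset_Rn[OF assms(2)] by blast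
  ultimately have "directions S \<subseteq> {0}" by auto
  moreover have "x - y \<in> directions S"
    unfolding directions_def using assms(3,4) by (intro span_base) blast
  ultimately show ?thesis by auto
qed

text \<open>\<open>cross\<close> is conditional on two distinct points, since no function is
  nonconstant on a single point; it handles fewer than \<open>n\<close> previous rows.
  \<open>meet\<close> handles exactly \<open>n\<close>, and beyond that the intersection is already
  empty.\<close>

lemma generic_layerI:
  assumes meet: "\<And>J j. J \<subseteq> {..<k} \<Longrightarrow> j < k \<Longrightarrow> j \<notin> J \<Longrightarrow>
      S J \<noteq> {} \<Longrightarrow> \<exists>x\<in>S J. affine_row n (W j) (b j) x \<noteq> 0"
    and cross: "\<And>J j x y. J \<subseteq> {..<k} \<Longrightarrow> j < k \<Longrightarrow> j \<notin> J \<Longrightarrow> x \<in> S J \<Longrightarrow> y \<in> S J \<Longrightarrow> x \<noteq> y \<Longrightarrow>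
      \<exists>x\<in>S J. \<exists>y\<in>S J. affine_row n (W j) (b j) x \<noteq> affine_row n (W j) (b j) y"
    and S: "\<And>J. S J = Rn n \<inter> (\<Inter>j\<in>J. solution_set n (W j) (b j))"
  shows "generic_layer n k W b"
proof -
  have "if card J \<le> n then affine (S J) \<and> affdim (S J) = int n - int (card J) else S J = {}"
    if "finite J" "J \<subseteq> {..<k}" for J
    using that
  proof (induction J)
    case empty
    have "Rn n \<noteq> {}" using subspace_0[OF subspace_Rn] by blast
    moreover have "directions (Rn n) = Rn n"
      using directions_base[OF subspace_imp_affine[OF subspace_Rn] subspace_0[OF subspace_Rn], of n]
      by simp
    ultimately show ?case
      by (simp add: S affdim_def dim_Rn subspace_imp_affine[OF subspace_Rn])
  next
    case (insert j J)
    have SJ: "S (insert j J) = S J \<inter> solution_set n (W j) (b j)"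
      by (auto simp: S)
    have sub: "S J \<subseteq> Rn n" by (auto simp: S)
    consider "card J < n" | "card J = n" | "card J > n" by linarith
    then show ?case
    proof cases
      case 1
      then have IH: "affine (S J)" "affdim (S J) = int n - int (card J)"
        using insert by auto
      then have "S J \<noteq> {}" using 1 by (auto simp: affdim_def)
      then obtain x where x: "x \<in> S J" by blast
      have "S J \<noteq> {x}"
      proof
        assume "S J = {x}"
        then have "directions (S J) = {0}"
          by (simp add: directions_def)
        then show False
          using IH(2) 1 \<open>S J \<noteq> {}\<close> by (simp add: affdim_def dim_singleton_zero)
      qed
      then obtain y where "y \<in> S J" "x \<noteq> y" using x by blast
      with x obtain x' y' where *: "x' \<in> S J" "y' \<in> S J"
          "affine_row n (W j) (b j) x' \<noteq> affine_row n (W j) (b j) y'"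
        using cross[of J j x y] insert by auto
      show ?thesis
        using affdim_hyperplane_section[OF IH(1) sub *] IH(2) 1 insert.hyps by (simp add: SJ)
    next
      case 2
      then have IH: "affdim (S J) = 0"
        using insert by auto
      then obtain x where "x \<in> S J" "affine_row n (W j) (b j) x \<noteq> 0"
        using meet[of J j] insert by (auto simp: affdim_def split: if_splits)
      then have "S (insert j J) = {}"
        using affdim_zero_singleton[OF IH sub] by (auto simp: SJ solution_set_def)
      then show ?thesis using 2 insert.hyps by simp
    next
      case 3
      then show ?thesis using insert by (simp add: SJ)
    qed
  qed
  then show ?thesis
    unfolding generic_layer_def Let_def S by (meson finite_subset finite_lessThan)
qed

text \<open>A zero row has everything or nothing as its solution set, of dimension \<open>n\<close>
  or -1, while genericity for a one-element \<open>J\<close> demands \<open>n - 1\<close>. The two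
  agree only at \<open>n = 0\<close>.\<close>

lemma generic_layer_nonzero_row:
  assumes "generic_layer n k W b" "0 < n" "j < k"
  shows "\<exists>l<n. W j l \<noteq> 0"
proof (rule ccontr)
  assume "\<not> ?thesis"
  then have "affine_row n (W j) (b j) x = b j" for x
    by (simp add: affine_row_def)
  then have eq: "Rn n \<inter> solution_set n (W j) (b j) = (if b j = 0 then Rn n else {})"
    by (auto simp: solution_set_def)
  have "affdim (Rn n \<inter> solution_set n (W j) (b j)) = int n - 1"
    using assms unfolding generic_layer_def Let_def by (auto dest: spec[where x = "{j}"])
  moreover have "affdim (Rn n) = int n"
    using directions_base[OF subspace_imp_affine[OF subspace_Rn] subspace_0[OF subspace_Rn], of n]
      subspace_0[OF subspace_Rn, of n] by (auto simp: affdim_def dim_Rn)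
  ultimately show False
    using assms(2) by (auto simp: eq affdim_def split: if_splits)
qed

section \<open>Cells as sign conditions\<close>

text \<open>\<open>P\<close> and \<open>M\<close> may overlap, and an index in both imposes an
  equation; top cells and their faces thus have the same form. The index type is left open to cover
  the rows of one layer as well as the neurons of several.\<close>

definition sign_cell :: "nat \<Rightarrow> ('i \<Rightarrow> rvec \<Rightarrow> real) \<Rightarrow> 'i set \<Rightarrow> 'i set \<Rightarrow> rvec set" where
  "sign_cell n f P M = {x \<in> Rn n. (\<forall>i\<in>P. 0 \<le> f i x) \<and> (\<forall>i\<in>M. f i x \<le> 0)}"

abbreviation row_cell ::
    "nat \<Rightarrow> (nat \<Rightarrow> nat \<Rightarrow> real) \<Rightarrow> (nat \<Rightarrow> real) \<Rightarrow> nat set \<Rightarrow> nat set \<Rightarrow> rvec set" where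
  "row_cell n W b \<equiv> sign_cell n (\<lambda>j. affine_row n (W j) (b j))"

lemma closed_row_cell: "closed (row_cell n W b P M)"
proof -
  have "row_cell n W b P M = Rn n \<inter> (\<Inter>j\<in>P. {x. 0 \<le> affine_row n (W j) (b j) x}) \<inter>
      (\<Inter>j\<in>M. {x. affine_row n (W j) (b j) x \<le> 0})"
    by (auto simp: sign_cell_def)
  also have "closed \<dots>"
    by (intro closed_Int closed_INT ballI closed_Rn closed_Collect_le continuous_on_affine_row
        continuous_on_const)
  finally show ?thesis .
qed

text \<open>Moving a point of the closed cell slightly towards the strict point \<open>u\<close>
  makes every weak inequality strict.\<close>

lemma closure_strict_row_cell:
  assumes u: "u \<in> Rn n" "\<And>j. j \<in> P \<Longrightarrow> 0 < affine_row n (W j) (b j) u"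
    "\<And>j. j \<in> M \<Longrightarrow> affine_row n (W j) (b j) u < 0"
  shows "closure {x \<in> Rn n. (\<forall>j\<in>P. 0 < affine_row n (W j) (b j) x) \<and>
    (\<forall>j\<in>M. affine_row n (W j) (b j) x < 0)} = row_cell n W b P M" (is "closure ?V = ?C")
proof
  show "closure ?V \<subseteq> ?C"
    by (intro closure_minimal closed_row_cell) (auto simp: sign_cell_def less_imp_le)
  show "?C \<subseteq> closure ?V"
  proof
    fix x assume x: "x \<in> ?C"
    let ?t = "\<lambda>k. inverse (real (Suc k))"
    let ?z = "\<lambda>k. (1 - ?t k) *\<^sub>R x + ?t k *\<^sub>R u"
    have t: "0 < ?t k" "?t k \<le> 1" for k
      by (auto simp: inverse_le_1_iff)
    have "?z k \<in> ?V" for k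
    proof -
      have f: "affine_row n w c (?z k) = (1 - ?t k) * affine_row n w c x + ?t k * affine_row n w c u"
        for w c
        by (rule affine_row_combination) simp
      have "?z k \<in> Rn n"
        using x u(1) by (auto simp: sign_cell_def intro!: subspace_add subspace_scale subspace_Rn)
      moreover have "0 < affine_row n (W j) (b j) (?z k)" if "j \<in> P" for j
        unfolding f using x u(2)[OF that] t[of k] that
        by (intro add_nonneg_pos mult_nonneg_nonneg mult_pos_pos) (auto simp: sign_cell_def)
      moreover have "affine_row n (W j) (b j) (?z k) < 0" if "j \<in> M" for j
        unfolding f using x u(3)[OF that] t[of k] that
        by (intro add_nonpos_neg mult_nonneg_nonpos mult_pos_neg) (auto simp: sign_cell_def)
      ultimately show ?thesis by blast
    qed
    moreover have "?z \<longlonglongrightarrow> (1 - 0) *\<^sub>R x + 0 *\<^sub>R u"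
      by (intro tendsto_intros LIMSEQ_inverse_real_of_nat)
    then have "?z \<longlonglongrightarrow> x" by simp
    ultimately show "x \<in> closure ?V"
      unfolding closure_sequential by (intro exI[of _ ?z]) simp
  qed
qed

text \<open>No row changes sign on a component, by connectedness; conversely the strict sign region
  is convex, so maximality of the component absorbs it.\<close>

lemma top_cell_row_cell:
  assumes C: "C \<in> top_cells n (layer_arrangement n k W b)"
    and W: "\<And>j. j < k \<Longrightarrow> \<exists>l<n. W j l \<noteq> 0"
  shows "\<exists>P M. P \<union> M = {..<k} \<and> C = row_cell n W b P M"
proof -
  let ?f = "\<lambda>j. affine_row n (W j) (b j)"
  have "j < k \<and> (\<exists>l<n. W j l \<noteq> 0) \<longleftrightarrow> j \<in> {..<k}" for j
    using W by blast
  then have "layer_arrangement n k W b = (\<lambda>j. solution_set n (W j) (b j)) ` {..<k}"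
    unfolding layer_arrangement_def by (simp only: Setcompr_eq_image Collect_mem_eq)
  then have A: "\<Union>(layer_arrangement n k W b) = {x \<in> Rn n. \<exists>j<k. ?f j x = 0}"
    by (auto simp: solution_set_def)
  obtain U where U: "U \<in> components (Rn n - \<Union>(layer_arrangement n k W b))" "C = closure U"
    using C by (auto simp: top_cells_def)
  then obtain u where u: "u \<in> U"
    using in_components_nonempty by blast
  have U_sub: "U \<subseteq> {x \<in> Rn n. \<forall>j<k. ?f j x \<noteq> 0}"
    using in_components_subset[OF U(1)] by (auto simp: A)
  define P where "P = {j. j < k \<and> 0 < ?f j u}"
  define M where "M = {j. j < k \<and> ?f j u < 0}"
  have "?f j u < 0 \<or> 0 < ?f j u" if "j < k" for j
    using u U_sub that by (auto simp: neq_iff[symmetric])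
  then have PM: "P \<union> M = {..<k}"
    by (auto simp: P_def M_def)
  let ?V = "{x \<in> Rn n. (\<forall>j\<in>P. 0 < ?f j x) \<and> (\<forall>j\<in>M. ?f j x < 0)}"
  have uV: "u \<in> ?V" using u U_sub by (auto simp: P_def M_def)
  have no_root: False
    if "x \<in> U" "j < k" "?f j x \<le> 0 \<and> 0 \<le> ?f j u \<or> ?f j u \<le> 0 \<and> 0 \<le> ?f j x" for x j
  proof -
    have "connected (?f j ` U)"
      by (intro connected_continuous_image continuous_on_affine_row in_components_connected[OF U(1)])
    then have "0 \<in> ?f j ` U"
      using that(3) imageI[OF that(1), of "?f j"] imageI[OF u, of "?f j"] connectedD_interval by blast
    then show False using U_sub that(2) by auto
  qed
  have "U \<subseteq> ?V"
  proof
    fix x assume x: "x \<in> U"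
    have "0 < ?f j x" if "j \<in> P" for j
      using no_root[OF x, of j] that by (auto simp: P_def not_less[symmetric])
    moreover have "?f j x < 0" if "j \<in> M" for j
      using no_root[OF x, of j] that by (auto simp: M_def not_less[symmetric])
    ultimately show "x \<in> ?V" using x U_sub by auto
  qed
  moreover have "?V \<subseteq> U"
  proof (rule components_maximal[OF U(1)])
    have "convex ?V"
    proof (rule convexI)
      fix x y :: rvec and r s :: real
      assume *: "x \<in> ?V" "y \<in> ?V" "0 \<le> r" "0 \<le> s" "r + s = 1"
      have f: "?f j (r *\<^sub>R x + s *\<^sub>R y) = r * ?f j x + s * ?f j y" for j
        using *(5) by (rule affine_row_combination)
      have "0 < r \<or> 0 < s" using * by linarith
      then have comb: "0 < r * p + s * q" if "0 < p" "0 < q" for p q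
        using that *(3,4) by (auto intro: add_pos_nonneg add_nonneg_pos)
      then have pos: "0 < ?f j (r *\<^sub>R x + s *\<^sub>R y)" if "0 < ?f j x" "0 < ?f j y" for j
        using that f comb by metis
      have "r * p + s * q < 0" if "p < 0" "q < 0" for p q
        using comb[of "- p" "- q"] that by simp
      then have neg: "?f j (r *\<^sub>R x + s *\<^sub>R y) < 0" if "?f j x < 0" "?f j y < 0" for j
        using that f by metis
      have "r *\<^sub>R x + s *\<^sub>R y \<in> Rn n"
        using * by (auto intro!: subspace_add subspace_scale subspace_Rn)
      then show "r *\<^sub>R x + s *\<^sub>R y \<in> ?V"
        using * pos neg by auto
    qed
    then show "connected ?V" by (rule convex_connected)
    have "?f j x \<noteq> 0" if "x \<in> ?V" "j < k" for x j
    proof -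
      have "j \<in> P \<or> j \<in> M" using PM that(2) by blast
      then show ?thesis using that(1) by auto
    qed
    then show "?V \<subseteq> Rn n - \<Union>(layer_arrangement n k W b)"
      by (auto simp: A)
    show "U \<inter> ?V \<noteq> {}" using u uV by blast
  qed
  ultimately have "C = row_cell n W b P M"
    using closure_strict_row_cell[of u n P W b M] uV U(2) by auto
  then show ?thesis using PM by blast
qed

text \<open>Supplies the step by which a segment can be prolonged without any of finitely many
  nonzero values changing sign.\<close>

lemma finite_scale_le:
  fixes a c :: "'i \<Rightarrow> real"
  assumes "finite J" "\<And>j. j \<in> J \<Longrightarrow> 0 < a j"
  shows "\<exists>e>0. \<forall>j\<in>J. e * \<bar>c j\<bar> \<le> a j"
  using assms
proof (induction J)
  case empty
  show ?case by (auto intro: exI[of _ 1])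
next
  case (insert i J)
  then obtain e where e: "e > 0" "\<forall>j\<in>J. e * \<bar>c j\<bar> \<le> a j" by auto
  \<comment> \<open>The \<open>+ 1\<close> keeps the denominator positive when \<open>c i\<close> is
    0.\<close>
  define d where "d = min e (a i / (\<bar>c i\<bar> + 1))"
  have "0 < d" using e(1) insert.prems by (simp add: d_def add_nonneg_pos)
  moreover have "d * \<bar>c i\<bar> \<le> a i"
  proof -
    have "d * (\<bar>c i\<bar> + 1) \<le> a i / (\<bar>c i\<bar> + 1) * (\<bar>c i\<bar> + 1)"
      by (intro mult_right_mono) (auto simp: d_def)
    also have "\<dots> = a i" by (simp add: add_nonneg_eq_0_iff)
    finally show ?thesis using \<open>0 < d\<close> by (simp add: distrib_left)
  qed
  moreover have "d * \<bar>c j\<bar> \<le> a j" if "j \<in> J" for j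
    using e(2) that mult_right_mono[of d e "\<bar>c j\<bar>"] by (force simp: d_def)
  ultimately show ?case by blast
qed

text \<open>Each row has one weak sign on \<open>T\<close>, so its values at two points cannot
  cancel at their midpoint, which inherits nonvanishing from either end.\<close>

lemma convex_common_nonzero:
  assumes T: "convex T" "T \<noteq> {}" and J: "finite J"
    and nz: "\<And>j. j \<in> J \<Longrightarrow> \<exists>x\<in>T. affine_row n (W j) (b j) x \<noteq> 0"
    and sgn: "\<And>j. j \<in> J \<Longrightarrow> (\<forall>x\<in>T. 0 \<le> affine_row n (W j) (b j) x) \<or>
      (\<forall>x\<in>T. affine_row n (W j) (b j) x \<le> 0)"
  shows "\<exists>x\<in>T. \<forall>j\<in>J. affine_row n (W j) (b j) x \<noteq> 0"
  using J nz sgn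
proof (induction J)
  case empty
  then show ?case using T(2) by auto
next
  case (insert i J)
  let ?f = "\<lambda>j. affine_row n (W j) (b j)"
  obtain x where x: "x \<in> T" "\<forall>j\<in>J. ?f j x \<noteq> 0"
    using insert by auto
  obtain y where y: "y \<in> T" "?f i y \<noteq> 0"
    using insert.prems(1)[of i] by blast
  let ?z = "(1/2) *\<^sub>R x + (1/2) *\<^sub>R y"
  have f: "?f j ?z = (1/2) * ?f j x + (1/2) * ?f j y" for j
    by (rule affine_row_combination) simp
  have "?z \<in> T" using x y by (intro convexD[OF T(1)]) auto
  moreover have "?f j ?z \<noteq> 0" if j: "j \<in> insert i J" for j
  proof -
    have "?f j x \<noteq> 0 \<or> ?f j y \<noteq> 0" using x y j by auto
    moreover have "0 \<le> ?f j x \<and> 0 \<le> ?f j y \<or> ?f j x \<le> 0 \<and> ?f j y \<le> 0"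
      using insert.prems(2)[OF j] x(1) y(1) by blast
    ultimately show ?thesis unfolding f by argo
  qed
  ultimately show ?case by blast
qed

text \<open>
  A nonempty face contains a point at which only the rows vanishing on the whole face vanish. Every
  other point of the cell on which those rows vanish ends a segment through that point which can be
  prolonged inside the cell, so the face property absorbs it.
\<close>

lemma face_of_row_cell:
  assumes T: "T face_of row_cell n W b P M" "T \<noteq> {}" and PM: "P \<union> M = {..<k}"
  shows "\<exists>P' M'. P' \<union> M' = {..<k} \<and> T = row_cell n W b P' M'"
proof -
  let ?f = "\<lambda>j. affine_row n (W j) (b j)"
  define Z where "Z = {j. j < k \<and> (\<forall>x\<in>T. ?f j x = 0)}"
  have sub: "T \<subseteq> row_cell n W b P M" and conv: "convex T"
    using T(1) face_of_imp_subset face_of_imp_convex by blast+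
  have sgn: "(\<forall>x\<in>T. 0 \<le> ?f j x) \<or> (\<forall>x\<in>T. ?f j x \<le> 0)" if "j < k" for j
  proof -
    have "j \<in> P \<or> j \<in> M" using that PM by auto
    then show ?thesis using sub by (auto simp: sign_cell_def)
  qed
  obtain p where p: "p \<in> T" "\<forall>j\<in>{..<k} - Z. ?f j p \<noteq> 0"
    using convex_common_nonzero[OF conv T(2), of "{..<k} - Z" n W b] sgn by (auto simp: Z_def)
  have "T = row_cell n W b (P \<union> Z) (M \<union> Z)"
  proof
    show "T \<subseteq> row_cell n W b (P \<union> Z) (M \<union> Z)"
      using sub by (auto simp: sign_cell_def Z_def)
    show "row_cell n W b (P \<union> Z) (M \<union> Z) \<subseteq> T"
    proof
      fix y assume y: "y \<in> row_cell n W b (P \<union> Z) (M \<union> Z)"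
      then have yC: "y \<in> row_cell n W b P M" by (auto simp: sign_cell_def)
      \<comment> \<open>With this \<open>e\<close>, passing from \<open>p\<close> to the prolonged
        point \<open>z\<close> changes a row outside \<open>Z\<close> by at most its absolute value
        at \<open>p\<close>, so its weak sign survives.\<close>
      obtain e where e: "e > 0" "\<forall>j\<in>{..<k} - Z. e * \<bar>?f j p - ?f j y\<bar> \<le> \<bar>?f j p\<bar>"
        using finite_scale_le[of "{..<k} - Z" "\<lambda>j. \<bar>?f j p\<bar>" "\<lambda>j. ?f j p - ?f j y"] p(2) by auto
      define z where "z = (1 + e) *\<^sub>R p + (- e) *\<^sub>R y"
      have "?f j z = (1 + e) * ?f j p + (- e) * ?f j y" for j
        unfolding z_def by (rule affine_row_combination) simp
      then have fz: "?f j z = ?f j p + e * (?f j p - ?f j y)" for j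
        by (simp add: algebra_simps)
      have pC: "p \<in> row_cell n W b P M" using p(1) sub by blast
      have z0: "?f j z = 0" if "j \<in> Z" for j
        using y that p(1) unfolding fz by (force simp: sign_cell_def Z_def)
      have z1: "\<bar>?f j z - ?f j p\<bar> \<le> \<bar>?f j p\<bar>" if "j < k" "j \<notin> Z" for j
        using e that unfolding fz by (simp add: abs_mult)
      have "z \<in> Rn n"
        using pC yC by (auto simp: z_def sign_cell_def intro!: subspace_add subspace_scale
            subspace_diff subspace_Rn)
      moreover have "0 \<le> ?f j z" if "j \<in> P" for j
      proof (cases "j \<in> Z")
        case False
        moreover have "0 \<le> ?f j p" using pC that by (simp add: sign_cell_def)
        moreover have "j < k" using that PM by blast
        ultimately show ?thesis using z1[of j] by linarith
      qed (simp add: z0)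
      moreover have "?f j z \<le> 0" if "j \<in> M" for j
      proof (cases "j \<in> Z")
        case False
        moreover have "?f j p \<le> 0" using pC that by (simp add: sign_cell_def)
        moreover have "j < k" using that PM by blast
        ultimately show ?thesis using z1[of j] by linarith
      qed (simp add: z0)
      ultimately have zC: "z \<in> row_cell n W b P M" by (simp add: sign_cell_def)
      show "y \<in> T"
      proof (cases "y = p")
        case False
        \<comment> \<open>\<open>u\<close> is 1/(1+e), from solving the definition of
          \<open>z\<close> for \<open>p\<close> as a combination of \<open>y\<close> and
          \<open>z\<close>.\<close>
        obtain u where u: "0 < u" "u < 1" "u * (1 + e) = 1" "1 - u = u * e"
        proof
          show "0 < 1 / (1 + e)" "1 / (1 + e) < 1" "1 / (1 + e) * (1 + e) = 1"
              "1 - 1 / (1 + e) = 1 / (1 + e) * e"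
            using e(1) by (auto simp: field_simps)
        qed
        have "(1 - u) *\<^sub>R y + u *\<^sub>R z = (u * (1 + e)) *\<^sub>R p"
          unfolding z_def u(4) by (simp add: algebra_simps)
        then have peq: "p = (1 - u) *\<^sub>R y + u *\<^sub>R z" unfolding u(3) by simp
        moreover have "y \<noteq> z"
        proof
          assume "y = z"
          with peq have "p = y" by (simp add: scaleR_left_distrib[symmetric])
          with False show False by simp
        qed
        ultimately have "p \<in> open_segment y z"
          using u(1,2) unfolding in_segment by blast
        then show ?thesis
          using face_ofD[OF T(1) _ yC zC p(1)] by blast
      qed (use p in simp)
    qed
  qed
  moreover have "(P \<union> Z) \<union> (M \<union> Z) = {..<k}" using PM by (auto simp: Z_def)
  ultimately show ?thesis by blast
qed

lemma arrangement_cell_row_cell: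
  assumes "C \<in> arrangement_complex n (layer_arrangement n k W b)" "C \<noteq> {}"
    and "\<And>j. j < k \<Longrightarrow> \<exists>l<n. W j l \<noteq> 0"
  shows "\<exists>P M. P \<union> M = {..<k} \<and> C = row_cell n W b P M"
proof -
  consider "C \<in> top_cells n (layer_arrangement n k W b)"
    | D where "D \<in> top_cells n (layer_arrangement n k W b)" "C face_of D"
    using assms(1) unfolding arrangement_complex_def by blast
  then show ?thesis
  proof cases
    case 1
    then show ?thesis using assms(3) by (rule top_cell_row_cell)
  next
    case 2
    obtain P M where "P \<union> M = {..<k}" "D = row_cell n W b P M"
      using top_cell_row_cell[OF 2(1) assms(3)] by blast
    then show ?thesis using face_of_row_cell[of C n W b P M k] 2(2) assms(2) by simp
  qed
qed

section \<open>Node maps and the cells of the canonical complex\<close>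

definition node :: "relu_network \<Rightarrow> nat \<times> nat \<Rightarrow> rvec \<Rightarrow> real" where
  "node N = (\<lambda>(i, j) x.
     affine_row (width N (i - 1)) (weight N i j) (bias N i j) (hidden_map N (i - 1) x))"

definition neurons :: "relu_network \<Rightarrow> nat \<Rightarrow> (nat \<times> nat) set" where
  "neurons N i = (SIGMA l:{1..i}. {..<width N l})"

lemma neurons_Suc: "neurons N (Suc i) = neurons N i \<union> Pair (Suc i) ` {..<width N (Suc i)}"
  by (auto simp: neurons_def le_Suc_eq)

lemma lookup_hidden_map_Suc:
  "Poly_Mapping.lookup (hidden_map N (Suc i) x) j =
    (if j < width N (Suc i) then max 0 (node N (Suc i, j) x) else 0)"
  by (simp add: layer_map_def layer_affine_def affine_map_def relu_def map.rep_eq lookup_mk_vec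
      node_def when_def max_def)

lemma node_apply:
  "node N (i, j) x =
    affine_row (width N (i - 1)) (weight N i j) (bias N i j) (hidden_map N (i - 1) x)"
  by (simp add: node_def)

lemma hidden_map_in_Rn: "x \<in> Rn (width N 0) \<Longrightarrow> hidden_map N i x \<in> Rn (width N i)"
  by (cases i) (auto simp: Rn_iff lookup_hidden_map_Suc simp del: hidden_map.simps(2))

text \<open>Pulling a row cell back along \<open>hidden_map\<close> turns conditions on rows into
  conditions on node maps, so each layer merely appends signs. The cells are thus captured by pairs
  of subsets of \<open>neurons N i\<close>, an index set independent of weights and biases.\<close>

lemma partial_complex_sign_cell:
  assumes "C \<in> partial_complex N i" "C \<noteq> {}"
    and "\<And>l j. 1 \<le> l \<Longrightarrow> l \<le> i \<Longrightarrow> j < width N l \<Longrightarrow> \<exists>q<width N (l - 1). weight N l j q \<noteq> 0"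
  shows "\<exists>P M. P \<union> M = neurons N i \<and> C = sign_cell (width N 0) (node N) P M"
  using assms
proof (induction N i arbitrary: C rule: partial_complex.induct)
  case (1 N)
  then have "C = sign_cell (width N 0) (node N) {} {}"
    by (simp add: sign_cell_def)
  moreover have "{} \<union> {} = neurons N 0" by (simp add: neurons_def)
  ultimately show ?case by blast
next
  case (2 N)
  from 2(1) have "C \<in> arrangement_complex (width N 0)
      (layer_arrangement (width N 0) (width N 1) (weight N 1) (bias N 1))"
    by (simp add: layer_complex_def)
  from arrangement_cell_row_cell[OF this 2(2)] 2(3)[of 1]
  obtain P M where PM: "P \<union> M = {..<width N 1}" "C = row_cell (width N 0) (weight N 1) (bias N 1) P M"
    by auto
  then have "C = sign_cell (width N 0) (node N) (Pair 1 ` P) (Pair 1 ` M)"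
    by (simp add: sign_cell_def node_def)
  moreover have "Pair 1 ` P \<union> Pair 1 ` M = neurons N (Suc 0)"
    using PM(1) by (auto simp: neurons_def)
  ultimately show ?case by blast
next
  case (3 N i)
  let ?l = "Suc (Suc i)"
  from "3.prems"(1) obtain S Y where SY: "S \<in> partial_complex N (Suc i)" "Y \<in> layer_complex N ?l"
      "C = S \<inter> hidden_map N (Suc i) -` Y"
    by auto
  then have "S \<noteq> {}" "Y \<noteq> {}" using "3.prems"(2) by auto
  obtain P M where PM: "P \<union> M = neurons N (Suc i)" "S = sign_cell (width N 0) (node N) P M"
    using "3.IH"[OF SY(1) \<open>S \<noteq> {}\<close>] "3.prems"(3) by (meson le_SucI)
  from SY(2) have "Y \<in> arrangement_complex (width N (Suc i))
      (layer_arrangement (width N (Suc i)) (width N ?l) (weight N ?l) (bias N ?l))"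
    by (simp add: layer_complex_def)
  from arrangement_cell_row_cell[OF this \<open>Y \<noteq> {}\<close>] "3.prems"(3)[of ?l]
  obtain P' M' where PM': "P' \<union> M' = {..<width N ?l}"
      "Y = row_cell (width N (Suc i)) (weight N ?l) (bias N ?l) P' M'"
    by auto
  have "C = sign_cell (width N 0) (node N) (P \<union> Pair ?l ` P') (M \<union> Pair ?l ` M')"
    using hidden_map_in_Rn[of _ N "Suc i"]
    by (auto simp: SY(3) PM(2) PM'(2) sign_cell_def ball_Un node_apply simp del: hidden_map.simps)
  moreover have "(P \<union> Pair ?l ` P') \<union> (M \<union> Pair ?l ` M') = neurons N ?l"
    using PM(1) PM'(1) by (auto simp: neurons_Suc[of N "Suc i"])
  ultimately show ?case by blast
qed

lemma affine_row_comp: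
  assumes "\<And>l. \<exists>w c. \<forall>x\<in>C. Poly_Mapping.lookup (h x) l = affine_row n w c x"
  shows "\<exists>w' c'. \<forall>x\<in>C. affine_row k w c (h x) = affine_row n w' c' x"
proof -
  obtain ws cs where h: "\<forall>x\<in>C. Poly_Mapping.lookup (h x) l = affine_row n (ws l) (cs l) x" for l
    using assms by metis
  have "affine_row k w c (h x) =
      affine_row n (\<lambda>q. \<Sum>l<k. w l * ws l q) ((\<Sum>l<k. w l * cs l) + c) x" if "x \<in> C" for x
  proof -
    have "(\<Sum>l<k. w l * Poly_Mapping.lookup (h x) l) =
        (\<Sum>l<k. \<Sum>q<n. w l * ws l q * Poly_Mapping.lookup x q) + (\<Sum>l<k. w l * cs l)"
      using that h by (simp add: affine_row_def distrib_left sum.distrib sum_distrib_left mult.assoc)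
    also have "(\<Sum>l<k. \<Sum>q<n. w l * ws l q * Poly_Mapping.lookup x q) =
        (\<Sum>q<n. (\<Sum>l<k. w l * ws l q) * Poly_Mapping.lookup x q)"
      by (subst sum.swap) (simp add: sum_distrib_right)
    finally show ?thesis by (simp add: affine_row_def)
  qed
  then show ?thesis by blast
qed

text \<open>A sign selects a branch of ReLU: the node itself for \<open>P\<close>, zero for
  \<open>M\<close>. Asking only for inclusion of the neurons lets the induction over layers keep one
  fixed cell.\<close>

lemma hidden_map_affine_on_cell:
  assumes "neurons N i \<subseteq> P \<union> M"
  shows "\<exists>w c. \<forall>x\<in>sign_cell (width N 0) (node N) P M.
    Poly_Mapping.lookup (hidden_map N i x) j = affine_row (width N 0) w c x"
  using assms
proof (induction i arbitrary: j)
  case 0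
  have "\<forall>x\<in>sign_cell (width N 0) (node N) P M.
      Poly_Mapping.lookup x j = affine_row (width N 0) (\<lambda>l. if l = j then 1 else 0) 0 x"
    by (auto simp: affine_row_def sign_cell_def Rn_iff if_distrib[of "\<lambda>t. t * _"] cong: if_cong)
  then show ?case by auto
next
  case (Suc i)
  let ?C = "sign_cell (width N 0) (node N) P M"
  have zero: "affine_row (width N 0) (\<lambda>_. 0) 0 x = 0" for x
    by (simp add: affine_row_def)
  show ?case
  proof (cases "j < width N (Suc i)")
    case True
    have "neurons N i \<subseteq> P \<union> M"
      using Suc.prems by (auto simp: neurons_Suc)
    then have "\<And>l. \<exists>w c. \<forall>x\<in>?C. Poly_Mapping.lookup (hidden_map N i x) l = affine_row (width N 0) w c x"
      by (rule Suc.IH)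
    from affine_row_comp[OF this, of "width N i" "weight N (Suc i) j" "bias N (Suc i) j"]
    have node: "\<exists>w c. \<forall>x\<in>?C. node N (Suc i, j) x = affine_row (width N 0) w c x"
      by (simp add: node_def)
    have "(Suc i, j) \<in> P \<union> M"
      using True Suc.prems by (auto simp: neurons_Suc)
    then show ?thesis
    proof
      assume "(Suc i, j) \<in> P"
      then have "\<forall>x\<in>?C. Poly_Mapping.lookup (hidden_map N (Suc i) x) j = node N (Suc i, j) x"
        using True by (auto simp: lookup_hidden_map_Suc sign_cell_def simp del: hidden_map.simps)
      then show ?thesis using node by metis
    next
      assume "(Suc i, j) \<in> M"
      then have "\<forall>x\<in>?C. Poly_Mapping.lookup (hidden_map N (Suc i) x) j = 0"
        using True by (auto simp: lookup_hidden_map_Suc sign_cell_def simp del: hidden_map.simps)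
      then show ?thesis using zero by metis
    qed
  next
    case False
    then have "\<forall>x. Poly_Mapping.lookup (hidden_map N (Suc i) x) j = 0"
      by (simp add: lookup_hidden_map_Suc del: hidden_map.simps)
    then show ?thesis using zero by metis
  qed
qed

text \<open>
  An affine function not vanishing identically on \<open>C\<close> is nonconstant on \<open>C\<close> as soon as it has a
  zero there, so its differential is nonzero in a direction of \<open>C\<close>.
\<close>

lemma transverse_on_cell_affine:
  assumes f: "\<And>x. x \<in> C \<Longrightarrow> f x = affine_row n w c x"
    and y: "y \<in> C" "f y \<noteq> 0"
  shows "transverse_on_cell f 0 C"
  unfolding transverse_on_cell_def
proof (intro ballI impI)
  fix x assume x: "x \<in> rel_interior C" "f x = 0"
  let ?D = "affine_row n w 0"
  have sub: "rel_interior C \<subseteq> C" by (rule rel_interior_subset)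
  have "(affine_row n w c has_derivative ?D) (at x within rel_interior C)"
  proof -
    have "((\<lambda>z. ?D z + c) has_derivative (\<lambda>z. ?D z + 0)) (at x within rel_interior C)"
      by (intro derivative_intros bounded_linear_imp_has_derivative bounded_linear_affine_row)
    moreover have "affine_row n w c = (\<lambda>z. ?D z + c)"
      using affine_row_eq by blast
    ultimately show ?thesis by simp
  qed
  then have "(f has_derivative ?D) (at x within rel_interior C)"
    using has_derivative_transform[OF x(1)] f sub by blast
  moreover have "?D ` directions C = UNIV"
  proof -
    have "s \<in> ?D ` directions C" for s
    proof -
      have d: "y - x \<in> directions C"
        unfolding directions_def using x(1) sub y(1) by (intro span_base) blast
      have "?D (y - x) = f y"
        using affine_row_diff[of n w y x c] f x y(1) sub by auto
      then have "?D ((s / f y) *\<^sub>R (y - x)) = s"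
        using y(2) by (simp add: linear_scale[OF bounded_linear.linear[OF bounded_linear_affine_row]])
      moreover have "(s / f y) *\<^sub>R (y - x) \<in> directions C"
        using d unfolding directions_def by (rule span_scale)
      ultimately show ?thesis by (metis imageI)
    qed
    then show ?thesis by auto
  qed
  ultimately show "\<exists>D. (f has_derivative D) (at x within rel_interior C) \<and> D ` directions C = UNIV"
    by blast
qed

text \<open>One nonvanishing statement serves both clauses of transversality: in positive dimension
  the node map is affine on the cell, and a cell of dimension 0 is a single point, so nonvanishing
  somewhere means everywhere.\<close>

lemma transversal_networkI:
  assumes row: "\<And>l j. 1 \<le> l \<Longrightarrow> l \<le> depth N \<Longrightarrow> j < width N l \<Longrightarrow>
      \<exists>q<width N (l - 1). weight N l j q \<noteq> 0"
    and nz: "\<And>i j P M. 1 \<le> i \<Longrightarrow> i \<le> depth N \<Longrightarrow> j < width N i \<Longrightarrow>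
      P \<union> M = neurons N (i - 1) \<Longrightarrow> sign_cell (width N 0) (node N) P M \<noteq> {} \<Longrightarrow>
      \<exists>x\<in>sign_cell (width N 0) (node N) P M. node N (i, j) x \<noteq> 0"
  shows "transversal_network N"
  unfolding transversal_network_def
proof (intro ballI allI impI)
  fix i j assume i: "i \<in> {1..depth N}" and j: "j < width N i"
  have "1 \<le> i" "i \<le> depth N" using i by auto
  have map: "network_map (node_network N i j) = node N (i, j)"
    using network_map_node_network[OF \<open>1 \<le> i\<close> j] j
    by (auto simp: fun_eq_iff layer_affine_def affine_map_def lookup_mk_vec node_def)
  have main: "transverse_on_cell (node N (i, j)) 0 C \<and> (\<exists>y\<in>C. node N (i, j) y \<noteq> 0) \<and>
      C \<subseteq> Rn (width N 0)"
    if C: "C \<in> partial_complex N (i - 1)" "C \<noteq> {}" for C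
  proof -
    obtain P M where PM: "P \<union> M = neurons N (i - 1)" "C = sign_cell (width N 0) (node N) P M"
      using partial_complex_sign_cell[OF C] row \<open>i \<le> depth N\<close> by (meson diff_le_self le_trans)
    obtain y where y: "y \<in> C" "node N (i, j) y \<noteq> 0"
      using nz[OF \<open>1 \<le> i\<close> \<open>i \<le> depth N\<close> j PM(1)] C(2) PM(2) by blast
    obtain w c where "\<forall>x\<in>C. node N (i, j) x = affine_row (width N 0) w c x"
      using affine_row_comp[OF hidden_map_affine_on_cell[of N "i - 1" P M],
          of "width N (i - 1)" "weight N i j" "bias N i j"] PM
      by (auto simp: node_def)
    then have "transverse_on_cell (node N (i, j)) 0 C"
      using y by (intro transverse_on_cell_affine) auto
    then show ?thesis using y PM(2) by (auto simp: sign_cell_def)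
  qed
  have "C \<noteq> {}" if "affdim C \<ge> 0" for C
    using that by (auto simp: affdim_def)
  then show "threshold_transversal_for (node_network N i j) 0"
    unfolding threshold_transversal_for_def transversal_threshold_def map
      canonical_complex_node_network[OF \<open>1 \<le> i\<close>]
    using main affdim_zero_singleton by (metis order_refl order_trans zero_le_one)
qed

section \<open>Almost every parameter\<close>

text \<open>Written in terms of \<open>\<theta>\<close> directly, so that continuity in the
  parameters and single-parameter updates can be read off without the record.\<close>

definition neuron_row :: "(nat \<Rightarrow> nat) \<Rightarrow> (parameter \<Rightarrow> real) \<Rightarrow> nat \<Rightarrow> nat \<Rightarrow> rvec \<Rightarrow> real" where
  "neuron_row n \<theta> i j = affine_row (n (i - 1)) (\<lambda>l. \<theta> (Weight i j l)) (\<theta> (Bias i j))"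

lemma network_of_simps [simp]:
  "depth (network_of m n \<theta>) = m"
  "width (network_of m n \<theta>) = n"
  "weight (network_of m n \<theta>) i j l = \<theta> (Weight i j l)"
  "bias (network_of m n \<theta>) i j = \<theta> (Bias i j)"
  by (simp_all add: network_of_def)

lemma affine_row_network_of:
  "affine_row (n (i - 1)) (weight (network_of m n \<theta>) i j) (bias (network_of m n \<theta>) i j) =
    neuron_row n \<theta> i j"
  by (simp add: neuron_row_def network_of_def)

lemma node_network_of:
  "node (network_of m n \<theta>) (i, j) x = neuron_row n \<theta> i j (hidden_map (network_of m n \<theta>) (i - 1) x)"
  unfolding node_apply network_of_simps(2) affine_row_network_of ..

section \<open>Dependence of rows and nodes on the parameters\<close>

lemma continuous_on_neuron_row:
  assumes "continuous_on S f" "\<And>l. continuous_on S (\<lambda>z. Poly_Mapping.lookup (h z) l)"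
  shows "continuous_on S (\<lambda>z. neuron_row n (f z) i j (h z))"
  unfolding neuron_row_def affine_row_def
  by (intro continuous_intros assms continuous_on_product_then_coordinatewise[OF assms(1)])

text \<open>Joint continuity in parameters and input makes sign conditions closed in the product
  space. The coordinatewise form is what the next row reads, so the induction closes.\<close>

lemma continuous_on_hidden_map:
  "continuous_on UNIV (\<lambda>z. Poly_Mapping.lookup (hidden_map (network_of m n (fst z)) i (snd z)) j)"
proof (induction i arbitrary: j)
  case 0
  show ?case by simp (intro continuous_intros)
next
  case (Suc i)
  have "continuous_on UNIV (\<lambda>z. neuron_row n (fst z) (Suc i) j (hidden_map (network_of m n (fst z)) i (snd z)))"
    by (intro continuous_on_neuron_row Suc continuous_intros)
  then have "continuous_on UNIV
      (\<lambda>z. max 0 (neuron_row n (fst z) (Suc i) j (hidden_map (network_of m n (fst z)) i (snd z))))"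
    by (intro continuous_intros)
  then show ?case
    unfolding lookup_hidden_map_Suc network_of_simps node_network_of
    by (cases "j < n (Suc i)") simp_all
qed

lemma continuous_on_node:
  "continuous_on UNIV (\<lambda>z. node (network_of m n (fst z)) (i, j) (snd z))"
  unfolding node_network_of by (intro continuous_on_neuron_row continuous_on_hidden_map continuous_intros)

lemma neuron_row_bias_upd: "neuron_row n (\<theta>(Bias i j := t)) i j x = neuron_row n \<theta> i j x - \<theta> (Bias i j) + t"
  by (simp add: neuron_row_def affine_row_def)

lemma neuron_row_weight_upd:
  assumes "l < n (i - 1)"
  shows "neuron_row n (\<theta>(Weight i j l := t)) i j x =
    neuron_row n \<theta> i j x + (t - \<theta> (Weight i j l)) * Poly_Mapping.lookup x l"
proof -
  have "(\<Sum>q<n (i - 1). (\<theta>(Weight i j l := t)) (Weight i j q) * Poly_Mapping.lookup x q) =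
      (\<Sum>q<n (i - 1). \<theta> (Weight i j q) * Poly_Mapping.lookup x q +
        (if q = l then (t - \<theta> (Weight i j l)) * Poly_Mapping.lookup x l else 0))"
    by (intro sum.cong) (auto simp: algebra_simps)
  also have "\<dots> = (\<Sum>q<n (i - 1). \<theta> (Weight i j q) * Poly_Mapping.lookup x q) +
      (t - \<theta> (Weight i j l)) * Poly_Mapping.lookup x l"
    using assms by (simp add: sum.distrib)
  finally show ?thesis by (simp add: neuron_row_def affine_row_def)
qed

lemma hidden_map_bias_upd:
  "l < i \<Longrightarrow> hidden_map (network_of m n (\<theta>(Bias i j := t))) l = hidden_map (network_of m n \<theta>) l"
  by (induction l) (simp_all add: layer_map_def layer_affine_def network_of_def)

lemma node_bias_upd:
  assumes "l < i"
  shows "node (network_of m n (\<theta>(Bias i j := t))) (l, k) x = node (network_of m n \<theta>) (l, k) x"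
proof -
  have "l - 1 < i" using assms by simp
  then show ?thesis
    using assms by (simp add: node_apply hidden_map_bias_upd) (simp add: network_of_def)
qed

text \<open>A positive \<open>card\<close> certifies finiteness, and the output layer alone
  contributes \<open>n m + 1\<close> to it.\<close>

lemma finite_parameters:
  assumes "n (Suc m) = 1"
  shows "finite (parameters m n)"
proof (rule card_ge_0_finite)
  have "(n m + 1) * n (Suc m) \<le> card (parameters m n)"
    unfolding card_parameters by (rule member_le_sum) auto
  then show "0 < card (parameters m n)" using assms by simp
qed

section \<open>Null sets for single rows, nodes and layers\<close>

context
  fixes m :: nat and n :: "nat \<Rightarrow> nat"
  assumes out: "n (Suc m) = 1"
begin

abbreviation (input) parameter_measure :: "(parameter \<Rightarrow> real) measure" where
  "parameter_measure \<equiv> \<Pi>\<^sub>M p \<in> parameters m n. (lborel :: real measure)"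

text \<open>\<open>j \<notin> J\<close> keeps the equations of the rows in \<open>J\<close> free of
  \<open>Bias i j\<close>, while row \<open>j\<close> moves with slope 1 in it.\<close>

lemma AE_neuron_row_not_vanishing:
  assumes "i \<in> {1..Suc m}" "j < n i" "j \<notin> J"
  shows "AE \<theta> in parameter_measure.
    (\<exists>x\<in>Rn (n (i - 1)). \<forall>q\<in>J. neuron_row n \<theta> i q x = 0) \<longrightarrow>
    (\<exists>x\<in>Rn (n (i - 1)). (\<forall>q\<in>J. neuron_row n \<theta> i q x = 0) \<and> neuron_row n \<theta> i j x \<noteq> 0)"
  unfolding UN_cube[symmetric]
proof (rule AE_not_vanishing[where p = "Bias i j"])
  show "finite (parameters m n)" using out by (rule finite_parameters)
  show "Bias i j \<in> parameters m n" using assms by (auto simp: parameters_def)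
  show "compact (cube (n (i - 1)) (real r))" for r by (rule compact_cube)
  have "closed (\<Inter>q\<in>J. {z. neuron_row n (fst z) i q (snd z) = 0})"
    by (intro closed_INT ballI closed_Collect_eq continuous_on_neuron_row continuous_intros)
  then show "closed {(\<theta>, x). \<forall>q\<in>J. neuron_row n \<theta> i q x = 0}"
    by (rule back_subst[of closed]) auto
  show "continuous_on UNIV (\<lambda>(\<theta>, x). neuron_row n \<theta> i j x)"
    unfolding split_beta by (intro continuous_on_neuron_row continuous_intros)
next
  fix \<theta> x t
  have "neuron_row n (\<theta>(Bias i j := t)) i q x = neuron_row n \<theta> i q x" if "q \<in> J" for q
    using that assms(3) by (auto simp: neuron_row_def)
  then show "(\<forall>q\<in>J. neuron_row n (\<theta>(Bias i j := t)) i q x = 0) \<longleftrightarrow> (\<forall>q\<in>J. neuron_row n \<theta> i q x = 0)"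
    by auto
qed (simp add: neuron_row_bias_upd)

text \<open>Normalising the difference in coordinate \<open>l\<close> to \<open>1\<close> makes the condition on the pair closed.\<close>

lemma AE_neuron_row_not_constant:
  assumes "i \<in> {1..Suc m}" "j < n i" "j \<notin> J" "l < n (i - 1)"
  shows "AE \<theta> in parameter_measure.
    (\<exists>z\<in>Rn (n (i - 1)) \<times> Rn (n (i - 1)).
      (\<forall>q\<in>J. neuron_row n \<theta> i q (fst z) = 0 \<and> neuron_row n \<theta> i q (snd z) = 0) \<and>
      Poly_Mapping.lookup (fst z) l - Poly_Mapping.lookup (snd z) l = 1) \<longrightarrow>
    (\<exists>z\<in>Rn (n (i - 1)) \<times> Rn (n (i - 1)).
      ((\<forall>q\<in>J. neuron_row n \<theta> i q (fst z) = 0 \<and> neuron_row n \<theta> i q (snd z) = 0) \<and>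
      Poly_Mapping.lookup (fst z) l - Poly_Mapping.lookup (snd z) l = 1) \<and>
      neuron_row n \<theta> i j (fst z) - neuron_row n \<theta> i j (snd z) \<noteq> 0)"
proof -
  let ?K = "\<lambda>r. cube (n (i - 1)) (real r) \<times> cube (n (i - 1)) (real r)"
  have K: "Rn (n (i - 1)) \<times> Rn (n (i - 1)) = (\<Union>r. ?K r)"
  proof
    \<comment> \<open>Both points of a pair must share one radius in the exhaustion; the larger one
      is taken.\<close>
    have mono: "cube (n (i - 1)) (real r) \<subseteq> cube (n (i - 1)) (real (max r s))"
      "cube (n (i - 1)) (real s) \<subseteq> cube (n (i - 1)) (real (max r s))" for r s
      by (auto simp: cube_def intro: order_trans[OF _ of_nat_mono[OF max.cobounded1]]
          order_trans[OF _ of_nat_mono[OF max.cobounded2]])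
    show "Rn (n (i - 1)) \<times> Rn (n (i - 1)) \<subseteq> (\<Union>r. ?K r)"
    proof clarify
      fix x y assume "x \<in> Rn (n (i - 1))" "y \<in> Rn (n (i - 1))"
      then obtain r s where "x \<in> cube (n (i - 1)) (real r)" "y \<in> cube (n (i - 1)) (real s)"
        unfolding UN_cube[symmetric] by blast
      then have "(x, y) \<in> ?K (max r s)" using mono by blast
      then show "(x, y) \<in> (\<Union>r. ?K r)" by blast
    qed
  qed (auto simp: cube_def)
  show ?thesis
    unfolding K
  proof (rule AE_not_vanishing[where p = "Weight i j l"])
    show "finite (parameters m n)" using out by (rule finite_parameters)
    show "Weight i j l \<in> parameters m n" using assms by (auto simp: parameters_def)
    show "compact (?K r)" for r by (intro compact_Times compact_cube)
    have "closed ((\<Inter>q\<in>J. {y. neuron_row n (fst y) i q (fst (snd y)) = 0} \<inter>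
          {y. neuron_row n (fst y) i q (snd (snd y)) = 0}) \<inter>
        {y. Poly_Mapping.lookup (fst (snd y)) l - Poly_Mapping.lookup (snd (snd y)) l = 1})"
      by (intro closed_INT closed_Int ballI closed_Collect_eq continuous_on_neuron_row continuous_intros)
    then show "closed {(\<theta>, z). (\<forall>q\<in>J. neuron_row n \<theta> i q (fst z) = 0 \<and> neuron_row n \<theta> i q (snd z) = 0) \<and>
        Poly_Mapping.lookup (fst z) l - Poly_Mapping.lookup (snd z) l = 1}"
      by (rule back_subst[of closed]) auto
    show "continuous_on UNIV (\<lambda>(\<theta>, z). neuron_row n \<theta> i j (fst z) - neuron_row n \<theta> i j (snd z))"
      unfolding split_beta by (intro continuous_on_neuron_row continuous_intros)
  next
    fix \<theta> t and z :: "rvec \<times> rvec"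
    have "neuron_row n (\<theta>(Weight i j l := t)) i q x = neuron_row n \<theta> i q x" if "q \<in> J" for q x
    proof -
      have "q \<noteq> j" using that assms(3) by blast
      then show ?thesis by (simp add: neuron_row_def)
    qed
    then show "((\<forall>q\<in>J. neuron_row n (\<theta>(Weight i j l := t)) i q (fst z) = 0 \<and>
          neuron_row n (\<theta>(Weight i j l := t)) i q (snd z) = 0) \<and>
        Poly_Mapping.lookup (fst z) l - Poly_Mapping.lookup (snd z) l = 1) \<longleftrightarrow>
        ((\<forall>q\<in>J. neuron_row n \<theta> i q (fst z) = 0 \<and> neuron_row n \<theta> i q (snd z) = 0) \<and>
        Poly_Mapping.lookup (fst z) l - Poly_Mapping.lookup (snd z) l = 1)"
      by auto
  next
    fix \<theta> s t and z :: "rvec \<times> rvec"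
    assume *: "(\<forall>q\<in>J. neuron_row n \<theta> i q (fst z) = 0 \<and> neuron_row n \<theta> i q (snd z) = 0) \<and>
        Poly_Mapping.lookup (fst z) l - Poly_Mapping.lookup (snd z) l = 1"
      "neuron_row n (\<theta>(Weight i j l := s)) i j (fst z) - neuron_row n (\<theta>(Weight i j l := s)) i j (snd z) = 0"
      "neuron_row n (\<theta>(Weight i j l := t)) i j (fst z) - neuron_row n (\<theta>(Weight i j l := t)) i j (snd z) = 0"
    \<comment> \<open>In \<open>Weight i j l\<close> the difference of the two values has the
      coordinate difference as slope; the normalisation makes this slope 1, whence
      injectivity.\<close>
    have eq: "neuron_row n (\<theta>(Weight i j l := t)) i j (fst z) - neuron_row n (\<theta>(Weight i j l := t)) i j (snd z) =
        neuron_row n \<theta> i j (fst z) - neuron_row n \<theta> i j (snd z) + (t - \<theta> (Weight i j l)) *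
          (Poly_Mapping.lookup (fst z) l - Poly_Mapping.lookup (snd z) l)" for t
      unfolding neuron_row_weight_upd[of l n i, OF assms(4)] by (simp add: algebra_simps)
    show "s = t" using * unfolding eq by simp
  qed
qed

lemma AE_node_not_vanishing:
  assumes "i \<in> {1..m}" "j < n i" "\<forall>a\<in>P \<union> M. fst a < i"
  shows "AE \<theta> in parameter_measure.
    sign_cell (n 0) (node (network_of m n \<theta>)) P M \<noteq> {} \<longrightarrow>
    (\<exists>x\<in>sign_cell (n 0) (node (network_of m n \<theta>)) P M. node (network_of m n \<theta>) (i, j) x \<noteq> 0)"
proof -
  let ?Q = "\<lambda>\<theta> x. (\<forall>a\<in>P. 0 \<le> node (network_of m n \<theta>) a x) \<and>
    (\<forall>a\<in>M. node (network_of m n \<theta>) a x \<le> 0)"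
  have "AE \<theta> in parameter_measure. (\<exists>x\<in>(\<Union>r. cube (n 0) (real r)). ?Q \<theta> x) \<longrightarrow>
      (\<exists>x\<in>(\<Union>r. cube (n 0) (real r)). ?Q \<theta> x \<and> node (network_of m n \<theta>) (i, j) x \<noteq> 0)"
  proof (rule AE_not_vanishing[where p = "Bias i j"])
    show "finite (parameters m n)" using out by (rule finite_parameters)
    show "Bias i j \<in> parameters m n" using assms by (auto simp: parameters_def)
    show "compact (cube (n 0) (real r))" for r by (rule compact_cube)
    have cont: "continuous_on UNIV (\<lambda>z. node (network_of m n (fst z)) a (snd z))" for a
      by (cases a) (simp add: continuous_on_node)
    have "closed ((\<Inter>a\<in>P. {z. 0 \<le> node (network_of m n (fst z)) a (snd z)}) \<inter>
        (\<Inter>a\<in>M. {z. node (network_of m n (fst z)) a (snd z) \<le> 0}))"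
      by (intro closed_INT closed_Int ballI closed_Collect_le cont continuous_on_const)
    then show "closed {(\<theta>, x). ?Q \<theta> x}"
      by (rule back_subst[of closed]) auto
    show "continuous_on UNIV (\<lambda>(\<theta>, x). node (network_of m n \<theta>) (i, j) x)"
      unfolding split_beta by (rule cont)
  next
    fix \<theta> x t
    have "node (network_of m n (\<theta>(Bias i j := t))) a x = node (network_of m n \<theta>) a x"
      if "a \<in> P \<union> M" for a
      using that assms(3) node_bias_upd[of "fst a" i m n \<theta> j t "snd a" x] by auto
    then show "?Q (\<theta>(Bias i j := t)) x \<longleftrightarrow> ?Q \<theta> x"
      by auto
  next
    fix \<theta> x s t
    have "i - 1 < i" using assms(1) by auto
    then have "node (network_of m n (\<theta>(Bias i j := t))) (i, j) x =
        node (network_of m n \<theta>) (i, j) x - \<theta> (Bias i j) + t" for t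
      by (simp add: node_network_of hidden_map_bias_upd neuron_row_bias_upd)
    then show "node (network_of m n (\<theta>(Bias i j := s))) (i, j) x = 0 \<Longrightarrow>
        node (network_of m n (\<theta>(Bias i j := t))) (i, j) x = 0 \<Longrightarrow> s = t"
      by simp
  qed
  then show ?thesis
    unfolding UN_cube by (rule eventually_mono) (auto simp: sign_cell_def)
qed

text \<open>The coordinate \<open>l\<close> in which two points of an intersection differ varies
  with \<open>\<theta>\<close>, so the nonconstancy statement is collected for all \<open>l\<close>
  beforehand.\<close>

lemma AE_generic_layer:
  assumes i: "i \<in> {1..Suc m}"
  shows "AE \<theta> in parameter_measure. generic_layer (n (i - 1)) (n i)
    (weight (network_of m n \<theta>) i) (bias (network_of m n \<theta>) i)"
proof -
  let ?I = "{(J, j). J \<subseteq> {..<n i} \<and> j < n i \<and> j \<notin> J}"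
  let ?R = "Rn (n (i - 1))"
  have "?I \<subseteq> Pow {..<n i} \<times> {..<n i}" by auto
  then have I: "countable ?I" "countable (?I \<times> {..<n (i - 1)})"
    by (auto intro!: countable_finite finite_subset[of ?I "Pow {..<n i} \<times> {..<n i}"]
        finite_cartesian_product)
  have "AE \<theta> in parameter_measure. \<forall>(J, j)\<in>?I.
    (\<exists>x\<in>?R. \<forall>q\<in>J. neuron_row n \<theta> i q x = 0) \<longrightarrow>
    (\<exists>x\<in>?R. (\<forall>q\<in>J. neuron_row n \<theta> i q x = 0) \<and> neuron_row n \<theta> i j x \<noteq> 0)"
    by (rule AE_ball_countable'[OF _ I(1)])
      (simp only: split_paired_all mem_Collect_eq split, elim conjE,
        rule AE_neuron_row_not_vanishing[OF i]; assumption)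
  moreover have "AE \<theta> in parameter_measure. \<forall>((J, j), l)\<in>?I \<times> {..<n (i - 1)}.
    (\<exists>z\<in>?R \<times> ?R.
      (\<forall>q\<in>J. neuron_row n \<theta> i q (fst z) = 0 \<and> neuron_row n \<theta> i q (snd z) = 0) \<and>
      Poly_Mapping.lookup (fst z) l - Poly_Mapping.lookup (snd z) l = 1) \<longrightarrow>
    (\<exists>z\<in>?R \<times> ?R.
      ((\<forall>q\<in>J. neuron_row n \<theta> i q (fst z) = 0 \<and> neuron_row n \<theta> i q (snd z) = 0) \<and>
      Poly_Mapping.lookup (fst z) l - Poly_Mapping.lookup (snd z) l = 1) \<and>
      neuron_row n \<theta> i j (fst z) - neuron_row n \<theta> i j (snd z) \<noteq> 0)"
    by (rule AE_ball_countable'[OF _ I(2)])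
      (simp only: split_paired_all mem_Collect_eq mem_Times_iff lessThan_iff fst_conv snd_conv split,
        elim conjE, rule AE_neuron_row_not_constant[OF i]; assumption)
  ultimately show ?thesis
  proof eventually_elim
    case (elim \<theta>)
    define S where "S J = ?R \<inter> (\<Inter>j\<in>J. solution_set (n (i - 1))
      (weight (network_of m n \<theta>) i j) (bias (network_of m n \<theta>) i j))" for J
    have S: "x \<in> S J \<longleftrightarrow> x \<in> ?R \<and> (\<forall>q\<in>J. neuron_row n \<theta> i q x = 0)" for x J
      unfolding S_def solution_set_def affine_row_network_of by blast
    show ?case
    proof (rule generic_layerI[where S = S])
      fix J j assume *: "J \<subseteq> {..<n i}" "j < n i" "j \<notin> J" "S J \<noteq> {}"
      have "(J, j) \<in> ?I" using * by simp
      from bspec[OF elim(1) this]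
      show "\<exists>x\<in>S J. affine_row (n (i - 1)) (weight (network_of m n \<theta>) i j)
          (bias (network_of m n \<theta>) i j) x \<noteq> 0"
        using *(4) unfolding affine_row_network_of by (auto simp: S Bex_def)
    next
      fix J j x y assume *: "J \<subseteq> {..<n i}" "j < n i" "j \<notin> J" "x \<in> S J" "y \<in> S J" "x \<noteq> y"
      obtain l where l: "Poly_Mapping.lookup x l \<noteq> Poly_Mapping.lookup y l"
        using *(6) by (auto simp: poly_mapping_eq_iff fun_eq_iff)
      have "\<not> n (i - 1) \<le> l"
        using l *(4,5) unfolding S Rn_iff by auto
      then have "((J, j), l) \<in> ?I \<times> {..<n (i - 1)}" using * by simp
      from bspec[OF elim(2) this]
      have cross: "(\<exists>z\<in>?R \<times> ?R.
      (\<forall>q\<in>J. neuron_row n \<theta> i q (fst z) = 0 \<and> neuron_row n \<theta> i q (snd z) = 0) \<and>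
          Poly_Mapping.lookup (fst z) l - Poly_Mapping.lookup (snd z) l = 1) \<Longrightarrow>
        (\<exists>z\<in>?R \<times> ?R.
      (\<forall>q\<in>J. neuron_row n \<theta> i q (fst z) = 0 \<and> neuron_row n \<theta> i q (snd z) = 0) \<and>
          neuron_row n \<theta> i j (fst z) - neuron_row n \<theta> i j (snd z) \<noteq> 0)"
        by auto
      \<comment> \<open>\<open>e\<close> rescales the difference of \<open>x\<close> and
        \<open>y\<close> to 1 in coordinate \<open>l\<close>. The point \<open>x'\<close> lies on
        their line, hence still in the affine set \<open>S J\<close>, and is paired with
        \<open>y\<close>.\<close>
      obtain e where e: "e * (Poly_Mapping.lookup x l - Poly_Mapping.lookup y l) = 1"
        using l by (metis eq_iff_diff_eq_0 left_inverse)
      define x' where "x' = e *\<^sub>R x + (1 - e) *\<^sub>R y"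
      have "neuron_row n \<theta> i q x' = e * neuron_row n \<theta> i q x + (1 - e) * neuron_row n \<theta> i q y" for q
        unfolding neuron_row_def x'_def by (rule affine_row_combination) simp
      moreover have "x' \<in> ?R"
        using *(4,5) unfolding x'_def S by (intro subspace_add subspace_scale subspace_Rn) auto
      moreover have "Poly_Mapping.lookup x' l - Poly_Mapping.lookup y l = 1"
        using e unfolding x'_def lookup_add lookup_scaleR by (simp add: algebra_simps)
      ultimately have "\<exists>z\<in>?R \<times> ?R. (\<forall>q\<in>J. neuron_row n \<theta> i q (fst z) = 0 \<and> neuron_row n \<theta> i q (snd z) = 0) \<and>
          Poly_Mapping.lookup (fst z) l - Poly_Mapping.lookup (snd z) l = 1"
        using *(4,5) by (intro bexI[of _ "(x', y)"]) (auto simp: S)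
      from cross[OF this]
      show "\<exists>x\<in>S J. \<exists>y\<in>S J. affine_row (n (i - 1)) (weight (network_of m n \<theta>) i j)
          (bias (network_of m n \<theta>) i j) x \<noteq> affine_row (n (i - 1)) (weight (network_of m n \<theta>) i j)
          (bias (network_of m n \<theta>) i j) y"
        unfolding affine_row_network_of by (auto simp: S Bex_def)
    qed (rule S_def)
  qed
qed

end

theorem theorem3:
  fixes m :: nat and n :: "nat \<Rightarrow> nat"
  assumes "\<And>i. i \<le> m \<Longrightarrow> 0 < n i"
    and "n (Suc m) = 1"
  shows "AE \<theta> in (\<Pi>\<^sub>M p \<in> parameters m n. (lborel :: real measure)).
    generic_network (network_of m n \<theta>) \<and> transversal_network (network_of m n \<theta>)"
proof -
  let ?N = "network_of m n" and ?M = "\<Pi>\<^sub>M p \<in> parameters m n. (lborel :: real measure)"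
  have "AE \<theta> in ?M. \<forall>i\<in>{1..Suc m}.
      generic_layer (n (i - 1)) (n i) (weight (?N \<theta>) i) (bias (?N \<theta>) i)"
    using AE_generic_layer[where m = m and n = n, OF assms(2)] by (intro AE_finite_allI) auto
  then have "AE \<theta> in ?M. generic_network (?N \<theta>)"
    by (simp add: generic_network_def)
  moreover
  let ?X = "\<lambda>i. SIGMA l:{1..i}. {..<n l}"
  \<comment> \<open>Built from the widths alone, so that this finite index set does not depend on
    \<open>\<theta>\<close>.\<close>
  let ?I = "SIGMA i:{1..m}. {..<n i} \<times> Pow (?X (i - 1)) \<times> Pow (?X (i - 1))"
  have "AE \<theta> in ?M. \<forall>a\<in>?I. case a of (i, j, P, M) \<Rightarrow>
      sign_cell (n 0) (node (?N \<theta>)) P M \<noteq> {} \<longrightarrow>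
      (\<exists>x\<in>sign_cell (n 0) (node (?N \<theta>)) P M. node (?N \<theta>) (i, j) x \<noteq> 0)"
  proof (rule AE_finite_allI)
    show "finite ?I" by (intro finite_SigmaI finite_cartesian_product) auto
    fix a assume "a \<in> ?I"
    then obtain i j P M where a: "a = (i, j, P, M)" "i \<in> {1..m}" "j < n i"
        "P \<subseteq> ?X (i - 1)" "M \<subseteq> ?X (i - 1)"
      by auto
    then have "\<forall>a\<in>P \<union> M. fst a < i" by force
    from AE_node_not_vanishing[where m = m and n = n, OF assms(2) a(2,3) this]
    show "AE \<theta> in ?M. case a of (i, j, P, M) \<Rightarrow>
      sign_cell (n 0) (node (?N \<theta>)) P M \<noteq> {} \<longrightarrow>
      (\<exists>x\<in>sign_cell (n 0) (node (?N \<theta>)) P M. node (?N \<theta>) (i, j) x \<noteq> 0)"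
      by (simp add: a(1))
  qed
  ultimately show ?thesis
  proof eventually_elim
    case (elim \<theta>)
    have "transversal_network (?N \<theta>)"
    proof (rule transversal_networkI)
      \<comment> \<open>Since \<open>l - 1 \<le> m\<close>, the input width of layer
        \<open>l\<close> is positive, and genericity of that layer rules out a zero row.\<close>
      fix l j assume "1 \<le> l" "l \<le> depth (?N \<theta>)" "j < width (?N \<theta>) l"
      then show "\<exists>q<width (?N \<theta>) (l - 1). weight (?N \<theta>) l j q \<noteq> 0"
        using elim(1) assms(1)[of "l - 1"]
          generic_layer_nonzero_row[of "n (l - 1)" "n l" "weight (?N \<theta>) l" "bias (?N \<theta>) l" j]
        by (simp add: generic_network_def)
    next
      fix i j P M assume *: "1 \<le> i" "i \<le> depth (?N \<theta>)" "j < width (?N \<theta>) i"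
        "P \<union> M = neurons (?N \<theta>) (i - 1)"
        "sign_cell (width (?N \<theta>) 0) (node (?N \<theta>)) P M \<noteq> {}"
      have "P \<union> M = ?X (i - 1)" using *(4) by (simp add: neurons_def)
      then have "(i, j, P, M) \<in> ?I" using *(1-3) by auto
      from bspec[OF elim(2) this] *(5)
      show "\<exists>x\<in>sign_cell (width (?N \<theta>) 0) (node (?N \<theta>)) P M. node (?N \<theta>) (i, j) x \<noteq> 0"
        by simp
    qed
    then show ?case using elim(1) by simp
  qed
qed

end
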